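(* Let $F$ be an elementary extension of the real exponential field $\mathbb R_{\exp}$, and let $X\in F$ be greater than every real number; identify $\mathrm{Sk}$ with a subset of $F$ by evaluating Skolem terms at $X$. For every $Q\in\mathrm{Sk}$ and every $c\in F$ with $c\ge 1$, the set $$D_c(Q)=\{r\in\mathbb R_{>0}: (f/Q)^c=r+o(1)\ \text{for some } f\in\mathrm{Sk}\}$$ is well ordered and has no accumulation point in $\mathbb R$. In particular $D_c(Q)\cap(0,R]$ is finite for every real $R>0$, and $|D_c(Q)|\le\omega$.
   Context: $\mathrm{Sk}$ (the Skolem functions) is the smallest set of germs at $+\infty$ of positive real functions containing the constant $1$ and the identity function and closed under addition, multiplication and exponentiation $(f,g)\mapsto f^g$, ordered by eventual comparison; this is known to be a well-order. Evaluating Skolem terms at $X$ in $F$ identifies $\mathrm{Sk}$ with an ordered subset of $F$, compatibly with addition, multiplication, exponentiation and order. In $F$, the logarithm on $F_{>0}$ is the inverse of the exponential, and $u^v=\exp(v\log u)$ for $u>0$. The notation $u=o(1)$ means $|u|<\epsilon$ for every real $\epsilon>0$. $|A|$ denotes the order type of a well-ordered set $A$. *)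

theory Defs
  imports "HOL-Analysis.Analysis"
begin

section \<open>Elementary extensions of the real exponential field\<close>

text \<open>First-order formulas in the language of ordered exponential rings, with named variables.\<close>

datatype tm =
    TVar nat | TZero | TOne | TAdd tm tm | TNeg tm | TMul tm tm | TExp tm

datatype fm =
    FEq tm tm | FLess tm tm | FNot fm | FAnd fm fm | FEx nat fm

primrec tm_val :: "('a::linordered_field \<Rightarrow> 'a) \<Rightarrow> (nat \<Rightarrow> 'a) \<Rightarrow> tm \<Rightarrow> 'a" where
  "tm_val E v (TVar n) = v n"
| "tm_val E v TZero = 0"
| "tm_val E v TOne = 1"
| "tm_val E v (TAdd s t) = tm_val E v s + tm_val E v t"
| "tm_val E v (TNeg s) = - tm_val E v s"
| "tm_val E v (TMul s t) = tm_val E v s * tm_val E v t"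
| "tm_val E v (TExp s) = E (tm_val E v s)"

primrec sat :: "('a::linordered_field \<Rightarrow> 'a) \<Rightarrow> (nat \<Rightarrow> 'a) \<Rightarrow> fm \<Rightarrow> bool" where
  "sat E v (FEq s t) \<longleftrightarrow> tm_val E v s = tm_val E v t"
| "sat E v (FLess s t) \<longleftrightarrow> tm_val E v s < tm_val E v t"
| "sat E v (FNot p) \<longleftrightarrow> \<not> sat E v p"
| "sat E v (FAnd p q) \<longleftrightarrow> sat E v p \<and> sat E v q"
| "sat E v (FEx n p) \<longleftrightarrow> (\<exists>a. sat E (v(n := a)) p)"

text \<open>
  The field \<open>F\<close> is a type \<open>'a\<close> with exponential \<open>E\<close>; the inclusion of the reals into \<open>F\<close> is
  an explicit map \<open>\<iota>\<close>. Every model of the theory of the real exponential field is an ordered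
  field, so the sort constraint does not restrict \<open>F\<close>.
\<close>

definition elementary_extension_Rexp ::
    "(real \<Rightarrow> 'a::linordered_field) \<Rightarrow> ('a \<Rightarrow> 'a) \<Rightarrow> bool" where
  "elementary_extension_Rexp \<iota> E \<longleftrightarrow>
     (\<forall>p (v :: nat \<Rightarrow> real). sat exp v p \<longleftrightarrow> sat E (\<iota> \<circ> v) p)"

text \<open>Only meaningful for \<open>u > 0\<close>.\<close>

definition Flog :: "('a::linordered_field \<Rightarrow> 'a) \<Rightarrow> 'a \<Rightarrow> 'a" where
  "Flog E u = inv E u"

definition Fpow :: "('a::linordered_field \<Rightarrow> 'a) \<Rightarrow> 'a \<Rightarrow> 'a \<Rightarrow> 'a" where
  "Fpow E u v = E (v * Flog E u)"

definition little_o_one :: "(real \<Rightarrow> 'a::linordered_field) \<Rightarrow> 'a \<Rightarrow> bool" where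
  "little_o_one \<iota> u \<longleftrightarrow> (\<forall>\<epsilon>::real. \<epsilon> > 0 \<longrightarrow> \<bar>u\<bar> < \<iota> \<epsilon>)"


section \<open>The Skolem functions\<close>

quotient_type germ = "real \<Rightarrow> real" / "\<lambda>f g. eventually (\<lambda>x. f x = g x) at_top"
  by (rule equivpI) (auto simp: reflp_def symp_def transp_def elim: eventually_elim2 eventually_mono)

instantiation germ :: "{one, plus, times}"
begin
lift_definition one_germ :: germ is "\<lambda>x. 1" .
lift_definition plus_germ :: "germ \<Rightarrow> germ \<Rightarrow> germ" is "\<lambda>f g x. f x + g x"
  by (auto elim: eventually_elim2)
lift_definition times_germ :: "germ \<Rightarrow> germ \<Rightarrow> germ" is "\<lambda>f g x. f x * g x"
  by (auto elim: eventually_elim2)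
instance ..
end

lift_definition id_germ :: germ is "\<lambda>x. x" .

lift_definition powr_germ :: "germ \<Rightarrow> germ \<Rightarrow> germ" is "\<lambda>f g x. f x powr g x"
  by (auto elim: eventually_elim2)

lift_definition pos_germ :: "germ \<Rightarrow> bool" is "\<lambda>f. eventually (\<lambda>x. f x > 0) at_top"
proof -
  fix f g :: "real \<Rightarrow> real"
  assume "eventually (\<lambda>x. f x = g x) at_top"
  then show "eventually (\<lambda>x. f x > 0) at_top = eventually (\<lambda>x. g x > 0) at_top"
    by (intro eventually_subst) (auto elim: eventually_mono)
qed

text \<open>
  The germs below are automatically positive (lemma \<open>Sk_pos\<close>), so \<open>powr\<close> is used only with a
  positive base.
\<close>

inductive_set Sk :: "germ set" where
  one: "1 \<in> Sk"
| id: "id_germ \<in> Sk"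
| add: "f \<in> Sk \<Longrightarrow> g \<in> Sk \<Longrightarrow> f + g \<in> Sk"
| mult: "f \<in> Sk \<Longrightarrow> g \<in> Sk \<Longrightarrow> f * g \<in> Sk"
| powr: "f \<in> Sk \<Longrightarrow> g \<in> Sk \<Longrightarrow> powr_germ f g \<in> Sk"

lemma Sk_pos: "f \<in> Sk \<Longrightarrow> pos_germ f"
proof (induction rule: Sk.induct)
  case one show ?case by transfer simp
next
  case id show ?case by transfer (rule eventually_gt_at_top)
next
  case (add f g)
  from add.IH show ?case by transfer (erule (1) eventually_elim2, rule add_pos_pos)
next
  case (mult f g)
  from mult.IH show ?case by transfer (erule (1) eventually_elim2, rule mult_pos_pos)
next
  case (powr f g)
  from powr.IH(1) show ?case by transfer (auto elim!: eventually_mono)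
qed

datatype skterm =
    SkOne | SkId | SkAdd skterm skterm | SkMul skterm skterm | SkPow skterm skterm

primrec skterm_germ :: "skterm \<Rightarrow> germ" where
  "skterm_germ SkOne = 1"
| "skterm_germ SkId = id_germ"
| "skterm_germ (SkAdd s t) = skterm_germ s + skterm_germ t"
| "skterm_germ (SkMul s t) = skterm_germ s * skterm_germ t"
| "skterm_germ (SkPow s t) = powr_germ (skterm_germ s) (skterm_germ t)"

primrec skterm_at :: "('a::linordered_field \<Rightarrow> 'a) \<Rightarrow> 'a \<Rightarrow> skterm \<Rightarrow> 'a" where
  "skterm_at E X SkOne = 1"
| "skterm_at E X SkId = X"
| "skterm_at E X (SkAdd s t) = skterm_at E X s + skterm_at E X t"
| "skterm_at E X (SkMul s t) = skterm_at E X s * skterm_at E X t"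
| "skterm_at E X (SkPow s t) = Fpow E (skterm_at E X s) (skterm_at E X t)"

text \<open>
  The identification of \<open>Sk\<close> with a subset of \<open>F\<close>: a germ in \<open>Sk\<close> goes to the value at \<open>X\<close>
  of any Skolem term denoting it. See \<open>Sk_at_skterm_germ\<close> for well-definedness.
\<close>

definition Sk_at :: "('a::linordered_field \<Rightarrow> 'a) \<Rightarrow> 'a \<Rightarrow> germ \<Rightarrow> 'a" where
  "Sk_at E X f = (THE u. \<exists>t. skterm_germ t = f \<and> skterm_at E X t = u)"

lemma Sk_eq_range: "Sk = range skterm_germ"
proof
  show "Sk \<subseteq> range skterm_germ"
  proof
    fix f assume "f \<in> Sk"
    then show "f \<in> range skterm_germ"
    proof induction
      case one show ?case by (rule range_eqI[of _ _ SkOne]) simp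
    next
      case id show ?case by (rule range_eqI[of _ _ SkId]) simp
    next
      case (add f g)
      then obtain s t where "f = skterm_germ s" "g = skterm_germ t" by blast
      then show ?case by (intro range_eqI[of _ _ "SkAdd s t"]) simp
    next
      case (mult f g)
      then obtain s t where "f = skterm_germ s" "g = skterm_germ t" by blast
      then show ?case by (intro range_eqI[of _ _ "SkMul s t"]) simp
    next
      case (powr f g)
      then obtain s t where "f = skterm_germ s" "g = skterm_germ t" by blast
      then show ?case by (intro range_eqI[of _ _ "SkPow s t"]) simp
    qed
  qed
next
  have "skterm_germ t \<in> Sk" for t
    by (induction t) (auto intro: Sk.intros)
  then show "range skterm_germ \<subseteq> Sk" by auto
qed

text \<open>
  \<open>graph_fm t x y k\<close> expresses that variable \<open>y\<close> is the value of \<open>t\<close> at variable \<open>x\<close>; variables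
  from \<open>k\<close> on serve as bound variables.
\<close>

primrec graph_fm :: "skterm \<Rightarrow> nat \<Rightarrow> nat \<Rightarrow> nat \<Rightarrow> fm" where
  "graph_fm SkOne x y k = FEq (TVar y) TOne"
| "graph_fm SkId x y k = FEq (TVar y) (TVar x)"
| "graph_fm (SkAdd s t) x y k = FEx k (FEx (k+1) (FAnd (graph_fm s x k (k+2))
     (FAnd (graph_fm t x (k+1) (k+2)) (FEq (TVar y) (TAdd (TVar k) (TVar (k+1)))))))"
| "graph_fm (SkMul s t) x y k = FEx k (FEx (k+1) (FAnd (graph_fm s x k (k+2))
     (FAnd (graph_fm t x (k+1) (k+2)) (FEq (TVar y) (TMul (TVar k) (TVar (k+1)))))))"
| "graph_fm (SkPow s t) x y k = FEx k (FEx (k+1) (FEx (k+2) (FAnd (graph_fm s x k (k+3))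
     (FAnd (graph_fm t x (k+1) (k+3)) (FAnd (FEq (TExp (TVar (k+2))) (TVar k))
       (FEq (TVar y) (TExp (TMul (TVar (k+1)) (TVar (k+2))))))))))"

definition exp_like :: "('a::linordered_field \<Rightarrow> 'a) \<Rightarrow> bool" where
  "exp_like E \<longleftrightarrow> inj E \<and> (\<forall>u. 0 < E u) \<and> (\<forall>u>0. \<exists>w. E w = u)"

lemma exp_like_exp: "exp_like (exp :: real \<Rightarrow> real)"
  unfolding exp_like_def by (auto simp: inj_def intro: exp_total exp_ln)

lemma exp_like_Flog: "exp_like E \<Longrightarrow> E w = u \<longleftrightarrow> 0 < u \<and> w = Flog E u"
  unfolding exp_like_def Flog_def by (metis inv_f_f)

lemma exp_like_E:
  assumes "elementary_extension_Rexp \<iota> E"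
  shows "exp_like E"
proof -
  have tr: "sat (exp :: real \<Rightarrow> real) (\<lambda>_. 0) p \<Longrightarrow> sat E (\<iota> \<circ> (\<lambda>_. 0)) p" for p
    using assms unfolding elementary_extension_Rexp_def by blast
  have "\<forall>a b. E a = E b \<longrightarrow> a = b"
    using tr[of "FNot (FEx 0 (FEx 1 (FAnd (FEq (TExp (TVar 0)) (TExp (TVar 1)))
        (FNot (FEq (TVar 0) (TVar 1))))))"] by simp
  moreover have "\<forall>a. 0 < E a"
    using tr[of "FNot (FEx 0 (FNot (FLess TZero (TExp (TVar 0)))))"] by simp
  moreover have "\<forall>u>0. \<exists>w. E w = u"
    using tr[of "FNot (FEx 0 (FAnd (FLess TZero (TVar 0)) (FNot (FEx 1
        (FEq (TExp (TVar 1)) (TVar 0))))))"] exp_total by simp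
  ultimately show ?thesis unfolding exp_like_def inj_def by blast
qed

lemma skterm_at_pos:
  assumes "exp_like E" "0 < X"
  shows "0 < skterm_at E X t"
  using assms by (induction t) (auto simp: exp_like_def Fpow_def)

lemma sat_graph_fm:
  assumes "exp_like E" "x < k" "y < k" "0 < v x"
  shows "sat E v (graph_fm t x y k) \<longleftrightarrow> v y = skterm_at E (v x) t"
  using assms
proof (induction t arbitrary: v y k)
  case (SkPow s t)
  then show ?case
    by (simp add: exp_like_Flog[OF \<open>exp_like E\<close>] Fpow_def skterm_at_pos)
qed auto

lemma skterm_at_exp:
  fixes x :: real
  assumes "x > 0"
  shows "skterm_at exp x (SkPow s t) = skterm_at exp x s powr skterm_at exp x t"
proof -
  have "0 < skterm_at exp x s"
    using skterm_at_pos[OF exp_like_exp assms] .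
  moreover from this have "Flog exp (skterm_at exp x s) = ln (skterm_at exp x s)"
    using exp_like_Flog[OF exp_like_exp] exp_ln by metis
  ultimately show ?thesis by (simp add: Fpow_def powr_def)
qed

lemma skterm_germ_abs: "skterm_germ t = abs_germ (\<lambda>x. skterm_at exp x t)"
proof (induction t)
  case (SkPow s t)
  have "eventually (\<lambda>x::real. skterm_at exp x (SkPow s t) =
      skterm_at exp x s powr skterm_at exp x t) at_top"
    using eventually_gt_at_top[of 0] by eventually_elim (rule skterm_at_exp)
  then show ?case
    using SkPow
    by (simp add: powr_germ.abs_eq germ.abs_eq_iff eq_commute)
qed (simp_all add: one_germ.abs_eq id_germ.abs_eq plus_germ.abs_eq times_germ.abs_eq
      one_germ_def id_germ_def)

lemma skterm_at_cong:
  assumes el: "elementary_extension_Rexp \<iota> E" and X: "\<And>r. \<iota> r < X"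
    and eq: "skterm_germ s = skterm_germ t"
  shows "skterm_at E X s = skterm_at E X t"
proof -
  have "eventually (\<lambda>x::real. skterm_at exp x s = skterm_at exp x t) at_top"
    using eq by (simp add: skterm_germ_abs germ.abs_eq_iff)
  then obtain N0 :: real where N0: "\<And>x. N0 \<le> x \<Longrightarrow> skterm_at exp x s = skterm_at exp x t"
    by (auto simp: eventually_at_top_linorder)
  define N where "N = max N0 0"
  let ?p = "FNot (FEx 1 (FAnd (FLess (TVar 0) (TVar 1)) (FAnd (FLess TZero (TVar 1))
     (FNot (FEx 2 (FAnd (graph_fm s 1 2 3) (graph_fm t 1 2 3)))))))"
  have "sat exp (\<lambda>_. N) ?p"
    using N0 by (auto simp: sat_graph_fm[OF exp_like_exp] N_def)
  then have p: "sat E (\<iota> \<circ> (\<lambda>_. N)) ?p"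
    using el unfolding elementary_extension_Rexp_def by blast
  have "\<iota> 0 = 0"
  proof -
    have "sat exp (\<lambda>_. 0) (FEq (TVar 0) TZero)" by simp
    then have "sat E (\<iota> \<circ> (\<lambda>_. 0)) (FEq (TVar 0) TZero)"
      using el unfolding elementary_extension_Rexp_def by blast
    then show ?thesis by simp
  qed
  then have "0 < X" using X[of 0] by simp
  then show ?thesis
    using p X[of N] by (auto simp: sat_graph_fm[OF exp_like_E[OF el]])
qed

lemma Sk_at_skterm_germ:
  assumes "elementary_extension_Rexp \<iota> E" "\<And>r. \<iota> r < X"
  shows "Sk_at E X (skterm_germ t) = skterm_at E X t"
  unfolding Sk_at_def using skterm_at_cong[OF assms] by (intro the_equality) blast+


section \<open>The sets of limits\<close>

definition D_set ::
    "(real \<Rightarrow> 'a::linordered_field) \<Rightarrow> ('a \<Rightarrow> 'a) \<Rightarrow> 'a \<Rightarrow> 'a \<Rightarrow> germ \<Rightarrow> real set" where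
  "D_set \<iota> E X c Q =
     {r. r > 0 \<and> (\<exists>f\<in>Sk. little_o_one \<iota> (Fpow E (Sk_at E X f / Sk_at E X Q) c - \<iota> r))}"

text \<open>
  The usual order restricted to \<open>A\<close>, as a reflexive relation, for use with \<open>well_order_on\<close> and
  the comparison \<open>ordLeq\<close> of order types. The order type of \<open>natLeq\<close> is \<open>\<omega>\<close>.
\<close>

definition le_on :: "real set \<Rightarrow> real rel" where
  "le_on A = {(x, y). x \<in> A \<and> y \<in> A \<and> x \<le> y}"

end

theory Submission
  imports Defs
begin

text \<open>
  Taking logarithms, an accumulation of $D_c(Q)$ below a bound yields, after passing to a
  subsequence (\<open>Sk\<close> is well ordered), a nondecreasing sequence $u_n$ of Skolem values with
  $c\,(\log u_n - \log u_0)$ bounded by a natural number, although the differences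
  $c\,(\log u_n - \log u_m)$ never become infinitesimal. Since $c \ge 1$, this says that
  $u_n - u_0 = O(d)$ for the scale $d = u_0/c$, whereas $u_n - u_m = o(d)$ fails for arbitrarily
  large $m \le n$. The theorem therefore reduces to a statement in which $c$ and $Q$ no longer
  occur: for \<^emph>\<open>every\<close> $d > 0$ in $F$, a nondecreasing sequence of Skolem values
  that is bounded at the scale $d$ (increments from the start $O(d)$) settles at the scale $d$
  (increments eventually $o(d)$). A sequence with this property for all $d$ is called regular, and
  \<open>regular_V\<close> says that all nondecreasing sequences of Skolem values are regular.

  Allowing all scales at once is what makes an induction possible, because every operation moves
  the scale in a predictable way. If $f = g + h$ with $g$ and $h$ nondecreasing, both summands are
  bounded at the scale of $f$. If $f = pq$, then $p$ is bounded at the scale $d/q_0$ and $q$ at the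
  scale $d/p_0$ (\<open>settles_at_product\<close>). Finally $\exp$ carries the scale $e$ to
  $e \exp(x_0)$ and back as long as $e$ is finite (\<open>settles_at_exp\<close>, \<open>settles_at_log\<close>),
  and so a power $A^B = \exp(B \log A)$ is handled as a product of $\log A$ and $B$
  (\<open>settles_at_Fpow\<close>).

  The induction is on an upper bound of the sequence in the well-ordered set of values. A bounded
  sequence $f$ that does not settle has a tail which stays below $\frac{17}{16} f_0$, where $f_0$ is
  now the first term of the tail; so a sequence whose terms are at most $\frac23 f_n$, or
  $\frac89 f_n$, lies below $f_0$ and is regular by induction. Every value splits
  (\<open>V_split\<close>) into two summands of which one has at most two thirds of the total and the other
  either has this property too or is a product or power with both arguments at least $2$ (or $1$ or
  $X$). The arguments of such a product or power are at most $\frac89$ of it. Hence all parts are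
  regular, and the operations above reassemble them (\<open>regular_step\<close>).

  That the values are well ordered is proved by a minimal descending sequence of terms
  (\<open>well_ordered_V\<close>). Of $F$ only the functional equation of the exponential, the
  inequality $1 + a \le \exp a$ and surjectivity onto the positive elements are used until the very
  end, where real numbers return as standard parts.
\<close>

section \<open>Monotone sequences in well-ordered sets\<close>

definition well_ordered :: "'a::linorder set \<Rightarrow> bool" where
  "well_ordered A \<longleftrightarrow> (\<forall>B\<subseteq>A. B \<noteq> {} \<longrightarrow> (\<exists>z\<in>B. \<forall>y\<in>B. z \<le> y))"

lemma mono_subseq:
  fixes f :: "nat \<Rightarrow> 'a::linorder"
  assumes A: "well_ordered A" and f: "\<And>n. f n \<in> A"
  obtains \<sigma> :: "nat \<Rightarrow> nat" where "strict_mono \<sigma>" "mono (f \<circ> \<sigma>)"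
proof -
  obtain \<sigma> :: "nat \<Rightarrow> nat" where \<sigma>: "strict_mono \<sigma>" "monoseq (f \<circ> \<sigma>)"
    using seq_monosub[of f] unfolding o_def by blast
  show thesis
  proof (cases "mono (f \<circ> \<sigma>)")
    case True
    then show thesis using that \<sigma> by blast
  next
    case False
    then have dec: "\<And>m n. m \<le> n \<Longrightarrow> f (\<sigma> n) \<le> f (\<sigma> m)"
      using \<sigma>(2) unfolding monoseq_def mono_def by auto
    have "range (f \<circ> \<sigma>) \<subseteq> A" "range (f \<circ> \<sigma>) \<noteq> {}" using f by auto
    then have "\<exists>z\<in>range (f \<circ> \<sigma>). \<forall>y\<in>range (f \<circ> \<sigma>). z \<le> y"
      using A unfolding well_ordered_def by blast
    then obtain N where N: "\<And>n. f (\<sigma> N) \<le> f (\<sigma> n)" by auto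
    have "f (\<sigma> (N + n)) = f (\<sigma> N)" for n
      using N dec[of N "N + n"] by (intro order_antisym) auto
    then have "mono (f \<circ> (\<lambda>n. \<sigma> (N + n)))" by (simp add: mono_def)
    moreover have "strict_mono (\<lambda>n. \<sigma> (N + n))"
      using \<sigma>(1) by (intro strict_monoI) (simp add: strict_mono_less)
    ultimately show thesis by (rule that[rotated])
  qed
qed

lemma mono_subseq2:
  fixes f g :: "nat \<Rightarrow> 'a::linorder"
  assumes A: "well_ordered A" and "\<And>n. f n \<in> A" "\<And>n. g n \<in> A"
  obtains \<sigma> :: "nat \<Rightarrow> nat" where "strict_mono \<sigma>" "mono (f \<circ> \<sigma>)" "mono (g \<circ> \<sigma>)"
proof -
  obtain \<rho> :: "nat \<Rightarrow> nat" where \<rho>: "strict_mono \<rho>" "mono (f \<circ> \<rho>)"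
    using mono_subseq[OF A, of f] assms by blast
  obtain \<tau> :: "nat \<Rightarrow> nat" where \<tau>: "strict_mono \<tau>" "mono ((g \<circ> \<rho>) \<circ> \<tau>)"
    using mono_subseq[OF A, of "g \<circ> \<rho>"] assms by auto
  have "mono ((f \<circ> \<rho>) \<circ> \<tau>)"
    using \<rho>(2) \<tau>(1) by (simp add: mono_def strict_mono_less_eq)
  moreover have "strict_mono (\<rho> \<circ> \<tau>)" using \<rho>(1) \<tau>(1) by (simp add: strict_mono_def)
  ultimately show thesis using that[of "\<rho> \<circ> \<tau>"] \<tau>(2) by (simp add: comp_assoc)
qed

lemma well_ordered_insert:
  assumes "well_ordered A" and "\<And>x. x \<in> A \<Longrightarrow> z < x"
  shows "well_ordered (insert z A)"
  unfolding well_ordered_def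
proof (intro allI impI)
  fix B assume B: "B \<subseteq> insert z A" "B \<noteq> {}"
  show "\<exists>w\<in>B. \<forall>y\<in>B. w \<le> y"
  proof (cases "z \<in> B")
    case True
    then show ?thesis using B assms(2) by (intro bexI[of _ z]) (auto intro: less_imp_le)
  next
    case False
    then have "B \<subseteq> A" using B by blast
    then show ?thesis using assms(1) B(2) unfolding well_ordered_def by blast
  qed
qed

lemma infinitely_often_subseq:
  fixes P :: "nat \<Rightarrow> bool"
  assumes "\<exists>\<^sub>\<infinity>n. P n"
  obtains \<sigma> :: "nat \<Rightarrow> nat" where "strict_mono \<sigma>" "\<And>n. P (\<sigma> n)"
proof -
  have inf: "infinite {n. P n}" using assms by (simp add: frequently_cofinite)
  show thesis
    using that[of "enumerate {n. P n}"] strict_mono_enumerate[OF inf] enumerate_in_set[OF inf]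
    by auto
qed

lemma infinitely_often_choice:
  fixes R :: "nat \<Rightarrow> 'a \<Rightarrow> 'b \<Rightarrow> bool"
  assumes "\<exists>\<^sub>\<infinity>n. \<exists>a b. R n a b"
  shows "\<exists>\<sigma> a b. strict_mono (\<sigma> :: nat \<Rightarrow> nat) \<and> (\<forall>n. R (\<sigma> n) (a n) (b n))"
proof -
  obtain \<sigma> :: "nat \<Rightarrow> nat" where \<sigma>: "strict_mono \<sigma>" "\<And>n. \<exists>a b. R (\<sigma> n) a b"
    using infinitely_often_subseq[OF assms] by blast
  then have "\<exists>a b. \<forall>n. R (\<sigma> n) (a n) (b n)" by metis
  with \<sigma>(1) show ?thesis by blast
qed

section \<open>Sequences measured at a scale\<close>

text \<open>
  An increment is \<open>O(d)\<close> if some natural multiple of \<open>d\<close> bounds it, and \<open>o(d)\<close> if no natural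
  multiple of it exceeds \<open>d\<close>. Natural multiples rather than real ones keep this theory independent
  of an embedding of the reals; smallness is one-sided because it is only applied to increments
  of monotone sequences.
\<close>

definition bounded_at :: "'a::linordered_field \<Rightarrow> (nat \<Rightarrow> 'a) \<Rightarrow> bool" where
  "bounded_at d f \<longleftrightarrow> (\<exists>k::nat. \<forall>n. f n - f 0 \<le> of_nat k * d)"

definition negligible_at :: "'a::linordered_field \<Rightarrow> 'a \<Rightarrow> bool" where
  "negligible_at d u \<longleftrightarrow> (\<forall>k::nat. of_nat k * u \<le> d)"

definition settles_at :: "'a::linordered_field \<Rightarrow> (nat \<Rightarrow> 'a) \<Rightarrow> bool" where
  "settles_at d f \<longleftrightarrow> (\<exists>N. \<forall>m\<ge>N. \<forall>n\<ge>m. negligible_at d (f n - f m))"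

definition regular :: "(nat \<Rightarrow> 'a::linordered_field) \<Rightarrow> bool" where
  "regular f \<longleftrightarrow> (\<forall>d>0. bounded_at d f \<longrightarrow> settles_at d f)"

lemma negligible_le_mult:
  assumes "negligible_at d u" "v \<le> of_nat K * u"
  shows "negligible_at d v"
  unfolding negligible_at_def
proof
  fix k :: nat
  have "of_nat k * v \<le> of_nat k * (of_nat K * u)"
    using assms(2) by (intro mult_left_mono) auto
  also have "\<dots> = of_nat (k * K) * u" by simp
  also have "\<dots> \<le> d" using assms(1) unfolding negligible_at_def by blast
  finally show "of_nat k * v \<le> d" .
qed

lemma negligible_le: "negligible_at d u \<Longrightarrow> v \<le> u \<Longrightarrow> negligible_at d v"
  using negligible_le_mult[of d u v 1] by simp

lemma negligible_add:
  assumes "negligible_at d u" "negligible_at d v"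
  shows "negligible_at d (u + v)"
  unfolding negligible_at_def
proof
  fix k :: nat
  have "of_nat (2 * k) * u \<le> d" "of_nat (2 * k) * v \<le> d"
    using assms unfolding negligible_at_def by blast+
  then show "of_nat k * (u + v) \<le> d" by (simp add: algebra_simps)
qed

lemma negligible_scale:
  assumes "negligible_at d u" "0 \<le> w"
  shows "negligible_at (d * w) (u * w)"
  unfolding negligible_at_def
proof
  fix k :: nat
  have "of_nat k * u * w \<le> d * w"
    using assms unfolding negligible_at_def by (intro mult_right_mono) auto
  then show "of_nat k * (u * w) \<le> d * w" by (simp add: mult.assoc)
qed

lemma settles_at_add:
  assumes "settles_at d f" "settles_at d g"
  shows "settles_at d (\<lambda>n. f n + g n)"
proof -
  obtain M N where
    "\<And>m n. M \<le> m \<Longrightarrow> m \<le> n \<Longrightarrow> negligible_at d (f n - f m)"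
    "\<And>m n. N \<le> m \<Longrightarrow> m \<le> n \<Longrightarrow> negligible_at d (g n - g m)"
    using assms unfolding settles_at_def by metis
  then have "negligible_at d (f n + g n - (f m + g m))" if "max M N \<le> m" "m \<le> n" for m n
    using negligible_add[of d "f n - f m" "g n - g m"] that by (simp add: algebra_simps)
  then show ?thesis unfolding settles_at_def by blast
qed

text \<open>
  Monotonicity squeezes the increments of the whole sequence between those of the subsequence.
  This lets every later argument thin out sequences until all their constituents are monotone and
  of one kind.
\<close>

lemma settles_at_subseq:
  fixes \<sigma> :: "nat \<Rightarrow> nat"
  assumes "mono f" "strict_mono \<sigma>" "settles_at d (f \<circ> \<sigma>)"
  shows "settles_at d f"
proof -
  obtain N where N: "\<And>m n. N \<le> m \<Longrightarrow> m \<le> n \<Longrightarrow> negligible_at d (f (\<sigma> n) - f (\<sigma> m))"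
    using assms(3) unfolding settles_at_def by auto
  have "negligible_at d (f n - f m)" if "\<sigma> N \<le> m" "m \<le> n" for m n
  proof (rule negligible_le)
    have "n \<le> \<sigma> n" "N \<le> \<sigma> N" using seq_suble[OF assms(2)] by auto
    then show "negligible_at d (f (\<sigma> n) - f (\<sigma> N))" using N that by auto
    have "f n \<le> f (\<sigma> n)" "f (\<sigma> N) \<le> f m"
      using monoD[OF assms(1)] that \<open>n \<le> \<sigma> n\<close> by auto
    then show "f n - f m \<le> f (\<sigma> n) - f (\<sigma> N)" by simp
  qed
  then show ?thesis unfolding settles_at_def by blast
qed

lemma bounded_at_subseq:
  assumes "mono f" "bounded_at d f"
  shows "bounded_at d (f \<circ> \<sigma>)"
proof -
  obtain k :: nat where k: "\<And>n. f n - f 0 \<le> of_nat k * d"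
    using assms unfolding bounded_at_def by blast
  have "f (\<sigma> n) - f (\<sigma> 0) \<le> of_nat k * d" for n
    using k[of "\<sigma> n"] monoD[OF assms(1), of 0 "\<sigma> 0"] by simp
  then show ?thesis unfolding bounded_at_def by auto
qed

lemma bounded_at_summand:
  assumes "bounded_at d (\<lambda>n. f n + g n)" "mono g"
  shows "bounded_at d f"
proof -
  obtain k :: nat where k: "\<And>n. f n + g n - (f 0 + g 0) \<le> of_nat k * d"
    using assms unfolding bounded_at_def by blast
  have "f n - f 0 \<le> of_nat k * d" for n
    using k[of n] monoD[OF assms(2), of 0 n] by simp
  then show ?thesis unfolding bounded_at_def by auto
qed

lemma regular_settles: "regular f \<Longrightarrow> 0 < d \<Longrightarrow> bounded_at d f \<Longrightarrow> settles_at d f"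
  unfolding regular_def by blast

lemma settles_at_const: "0 \<le> d \<Longrightarrow> settles_at d (\<lambda>n. a)"
  unfolding settles_at_def negligible_at_def by simp

text \<open>
  The increments satisfy
  $p_n q_n - p_m q_m = (p_n - p_m) q_n + p_m (q_n - q_m)$ with both terms nonnegative. With $m = 0$
  this bounds $p$ and $q$ at the scales \<open>d / q 0\<close> and \<open>d / p 0\<close>. Conversely, when both settle
  there, the factors $q_n$ and $p_m$ are harmless because they are at most a fixed natural multiple
  of $q_0$ and $p_0$; this uses that \<open>d\<close> is not large compared with $p_0 q_0$.
\<close>

lemma settles_at_product:
  fixes p q :: "nat \<Rightarrow> 'a::linordered_field"
  assumes mono: "mono p" "mono q" and pos: "0 < p 0" "0 < q 0" and d: "0 < d"
    and small: "d \<le> of_nat C * (p 0 * q 0)"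
    and bdd: "bounded_at d (\<lambda>n. p n * q n)"
    and p: "bounded_at (d / q 0) p \<Longrightarrow> settles_at (d / q 0) p"
    and q: "bounded_at (d / p 0) q \<Longrightarrow> settles_at (d / p 0) q"
  shows "settles_at d (\<lambda>n. p n * q n)"
proof -
  obtain k :: nat where k: "\<And>n. p n * q n - p 0 * q 0 \<le> of_nat k * d"
    using bdd unfolding bounded_at_def by blast
  have p0: "p 0 \<le> p n" and q0: "q 0 \<le> q n" for n using monoD mono by blast+
  have expand: "p n * q n - p m * q m = (p n - p m) * q n + p m * (q n - q m)" for m n
    by (simp add: algebra_simps)
  have pk: "(p n - p 0) * q 0 \<le> of_nat k * d" and qk: "p 0 * (q n - q 0) \<le> of_nat k * d" for n
  proof -
    have "(p n - p 0) * q 0 \<le> (p n - p 0) * q n" "0 \<le> (p n - p 0) * q 0" "0 \<le> p 0 * (q n - q 0)"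
      using p0[of n] q0[of n] pos by (auto intro: mult_left_mono)
    then show "(p n - p 0) * q 0 \<le> of_nat k * d" "p 0 * (q n - q 0) \<le> of_nat k * d"
      using k[of n] unfolding expand[of n 0] by linarith+
  qed
  have "bounded_at (d / q 0) p" "bounded_at (d / p 0) q"
    unfolding bounded_at_def using pk qk pos by (auto simp: field_simps intro!: exI[of _ k])
  then have "settles_at (d / q 0) p" "settles_at (d / p 0) q" using p q by blast+
  then obtain M N where
    M: "\<And>m n. M \<le> m \<Longrightarrow> m \<le> n \<Longrightarrow> negligible_at (d / q 0) (p n - p m)" and
    N: "\<And>m n. N \<le> m \<Longrightarrow> m \<le> n \<Longrightarrow> negligible_at (d / p 0) (q n - q m)"
    unfolding settles_at_def by metis
  have K: "of_nat k * d \<le> of_nat (k * C) * (p 0 * q 0)"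
    using mult_left_mono[OF small, of "of_nat k"] by simp
  have pK: "p n \<le> of_nat (1 + k * C) * p 0" for n
  proof -
    have "(p n - p 0) * q 0 \<le> (of_nat (k * C) * p 0) * q 0"
      using order_trans[OF pk[of n] K] by (simp add: mult_ac)
    then have "p n - p 0 \<le> of_nat (k * C) * p 0" using pos(2) mult_le_cancel_right_pos by blast
    then show ?thesis by (simp add: algebra_simps)
  qed
  have qK: "q n \<le> of_nat (1 + k * C) * q 0" for n
  proof -
    have "p 0 * (q n - q 0) \<le> p 0 * (of_nat (k * C) * q 0)"
      using order_trans[OF qk[of n] K] by (simp add: mult_ac)
    then have "q n - q 0 \<le> of_nat (k * C) * q 0" using pos(1) mult_le_cancel_left_pos by blast
    then show ?thesis by (simp add: algebra_simps)
  qed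
  have "negligible_at d (p n * q n - p m * q m)" if mn: "max M N \<le> m" "m \<le> n" for m n
    unfolding expand
  proof (rule negligible_add)
    have le: "p m \<le> p n" "q m \<le> q n" using monoD mono mn by blast+
    have "negligible_at (d / q 0 * q 0) ((p n - p m) * q 0)"
      using M mn pos by (intro negligible_scale) auto
    then have "negligible_at d ((p n - p m) * q 0)" using pos by simp
    then show "negligible_at d ((p n - p m) * q n)"
    proof (rule negligible_le_mult)
      show "(p n - p m) * q n \<le> of_nat (1 + k * C) * ((p n - p m) * q 0)"
        using mult_left_mono[OF qK[of n], of "p n - p m"] le by (simp only: mult_ac)
    qed
    have "negligible_at (d / p 0 * p 0) ((q n - q m) * p 0)"
      using N mn pos by (intro negligible_scale) auto
    then have "negligible_at d ((q n - q m) * p 0)" using pos by simp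
    then show "negligible_at d (p m * (q n - q m))"
    proof (rule negligible_le_mult)
      show "p m * (q n - q m) \<le> of_nat (1 + k * C) * ((q n - q m) * p 0)"
        using mult_right_mono[OF pK[of m], of "q n - q m"] le by (simp only: mult_ac)
    qed
  qed
  then show ?thesis unfolding settles_at_def by blast
qed

text \<open>
  Each time the ratio \<open>17 / 16\<close> is exceeded again, the sequence gains at least $f_0 / 16$, which
  can happen only finitely often below \<open>K * f 0\<close>. Any ratio greater than $1$ would do; the
  bound needed later is that $\frac{17}{16} \cdot \frac89 < 1$, where $\frac89$ comes from
  comparing an exponent with its power.
\<close>

lemma settled_ratio:
  fixes f :: "nat \<Rightarrow> 'a::linordered_field"
  assumes "mono f" "0 < f 0" "\<And>n. f n \<le> of_nat K * f 0"
  obtains N where "\<And>n. N \<le> n \<Longrightarrow> 16 * f n \<le> 17 * f N"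
proof -
  have "\<exists>N. \<forall>n\<ge>N. 16 * f n \<le> 17 * f N"
  proof (rule ccontr)
    assume "\<not> ?thesis"
    then have ex: "\<And>N. \<exists>n. 17 * f N < 16 * f n" by (metis not_le)
    have "\<exists>n. of_nat (16 + k) * f 0 \<le> 16 * f n" for k
    proof (induction k)
      case 0
      then show ?case by auto
    next
      case (Suc k)
      then obtain n where n: "of_nat (16 + k) * f 0 \<le> 16 * f n" by blast
      obtain m where "17 * f n < 16 * f m" using ex by blast
      moreover have "f 0 \<le> f n" using monoD assms(1) by blast
      ultimately have "of_nat (16 + Suc k) * f 0 \<le> 16 * f m"
        using n by (simp add: algebra_simps)
      then show ?case by blast
    qed
    from this[of "16 * K"] obtain n where "of_nat (16 + 16 * K) * f 0 \<le> 16 * f n" by blast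
    then show False using assms(3)[of n] assms(2) by (simp add: algebra_simps)
  qed
  then show thesis using that by blast
qed

text \<open>
  If all terms are \<open>o(d)\<close>, then so are all increments. A sequence that does not settle
  thus has a term that is not negligible at the scale \<open>d\<close>, and from there on boundedness at
  the scale \<open>d\<close> becomes boundedness relative to that term.
\<close>

lemma unsettled_tail:
  fixes f :: "nat \<Rightarrow> 'a::linordered_field"
  assumes "mono f" "\<And>n. 0 \<le> f n" "0 < d" and bdd: "bounded_at d f" and "\<not> settles_at d f"
  obtains N C where "\<And>n. N \<le> n \<Longrightarrow> 16 * f n \<le> 17 * f N" "d \<le> of_nat C * f N" "0 < f N"
proof -
  obtain k :: nat where k: "\<And>n. f n - f 0 \<le> of_nat k * d"
    using bdd unfolding bounded_at_def by blast
  have "\<exists>M C. d \<le> of_nat C * f M"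
  proof (rule ccontr)
    assume "\<not> ?thesis"
    then have "negligible_at d (f M)" for M
      unfolding negligible_at_def by (auto simp: not_le intro: less_imp_le)
    then have "negligible_at d (f n - f m)" for m n
      using negligible_le[of d "f n" "f n - f m"] assms(2)[of m] by simp
    then show False using assms(5) unfolding settles_at_def by blast
  qed
  then obtain M C where MC: "d \<le> of_nat C * f M" by blast
  have pos: "0 < f M" using MC assms(2)[of M] \<open>0 < d\<close> by (cases "f M = 0") auto
  let ?g = "\<lambda>n. f (M + n)"
  have "mono ?g" using assms(1) by (simp add: mono_def)
  moreover have "?g n \<le> of_nat (1 + k * C) * ?g 0" for n
  proof -
    have "f (M + n) \<le> f M + of_nat k * d"
      using k[of "M + n"] monoD[OF assms(1), of 0 M] by simp
    also have "of_nat k * d \<le> of_nat k * (of_nat C * f M)" using MC by (intro mult_left_mono) auto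
    finally show ?thesis by (simp add: algebra_simps)
  qed
  ultimately obtain N where N: "\<And>n. N \<le> n \<Longrightarrow> 16 * ?g n \<le> 17 * ?g N"
    using settled_ratio[of ?g "1 + k * C"] pos by auto
  have le: "f M \<le> f (M + N)" using monoD[OF assms(1)] by simp
  show thesis
  proof (rule that[of "M + N" C])
    show "16 * f n \<le> 17 * f (M + N)" if "M + N \<le> n" for n
      using N[of "n - M"] that by simp
    show "d \<le> of_nat C * f (M + N)"
      using MC mult_left_mono[OF le, of "of_nat C"] by simp
    show "0 < f (M + N)" using pos le by simp
  qed
qed

section \<open>Ordered fields with an exponential\<close>

locale exponential_field =
  fixes E :: "'a::linordered_field \<Rightarrow> 'a"
  assumes E_add: "E (a + b) = E a * E b"
    and E_ge: "1 + a \<le> E a"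
    and E_onto: "0 < u \<Longrightarrow> \<exists>w. E w = u"
begin

lemma E_0 [simp]: "E 0 = 1"
proof -
  have "E 0 * E 0 = E 0" using E_add[of 0 0] by simp
  then show ?thesis using E_ge[of 0] by simp
qed

lemma E_minus: "E a * E (- a) = 1"
  using E_add[of a "- a"] by simp

lemma E_pos [simp]: "0 < E a"
proof -
  have "E a = E (a / 2) * E (a / 2)" using E_add[of "a / 2" "a / 2"] by simp
  moreover have "E a \<noteq> 0" using E_minus[of a] by auto
  ultimately show ?thesis by (auto simp: zero_less_mult_iff not_less neq_iff)
qed

lemma E_diff: "E (a - b) = E a / E b"
  using E_add[of "a - b" b] by (simp add: field_simps less_imp_neq[OF E_pos, symmetric])

text \<open>
  The tangent inequality and its mirror image replace derivatives: they compare increments of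
  \<open>E \<circ> x\<close> with increments of \<open>x\<close> from both sides.
\<close>

lemma E_tangent: "E u * (v - u) \<le> E v - E u"
proof -
  have "E u * (1 + (v - u)) \<le> E u * E (v - u)"
    by (intro mult_left_mono E_ge) (simp add: less_imp_le)
  also have "\<dots> = E v" using E_add[of u "v - u"] by simp
  finally show ?thesis by (simp add: algebra_simps)
qed

lemma E_tangent': "E v - E u \<le> E v * (v - u)"
  using E_tangent[of v u] by (simp add: algebra_simps)

lemma E_less: "a < b \<Longrightarrow> E a < E b"
proof -
  assume "a < b"
  then have "0 < E a * (b - a)" by simp
  then show ?thesis using E_tangent[of a b] by simp
qed

lemma E_le_iff [simp]: "E a \<le> E b \<longleftrightarrow> a \<le> b"
  using E_less[of a b] E_less[of b a] by (cases a b rule: linorder_cases) auto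

lemma inj_E: "inj E"
proof (rule injI)
  fix a b assume "E a = E b"
  then have "E a \<le> E b" "E b \<le> E a" by simp_all
  then show "a = b" unfolding E_le_iff by (rule order_antisym)
qed

lemma Flog_E [simp]: "Flog E (E a) = a"
  unfolding Flog_def using inj_E by simp

lemma E_Flog [simp]: "0 < u \<Longrightarrow> E (Flog E u) = u"
  using E_onto[of u] by auto

lemma Flog_le: "0 < u \<Longrightarrow> u \<le> v \<Longrightarrow> Flog E u \<le> Flog E v"
  using E_le_iff[of "Flog E u" "Flog E v"] by simp

lemma E_half_le: "E (1 / 2) \<le> 2"
proof -
  have "1 / 2 \<le> E (- (1 / 2))" using E_ge[of "- (1 / 2)"] by simp
  then have "E (1/2) * (1 / 2) \<le> E (1/2) * E (- (1 / 2))" by (intro mult_left_mono) (auto simp: less_imp_le)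
  then show ?thesis unfolding E_minus by simp
qed

lemma Flog_ge_half: "2 \<le> u \<Longrightarrow> 1 / 2 \<le> Flog E u"
  using E_half_le E_le_iff[of "1/2" "Flog E u"] by (simp del: E_le_iff)

lemma E_of_nat_le: "E (of_nat m) \<le> of_nat (4 ^ m)"
proof (induction m)
  case (Suc m)
  have "E 1 = E (1/2) * E (1/2)" using E_add[of "1/2" "1/2"] by simp
  also have "\<dots> \<le> 2 * 2" using E_half_le by (intro mult_mono) (auto simp: less_imp_le)
  finally have "E 1 * E (of_nat m) \<le> 4 * of_nat (4 ^ m)"
    using Suc by (intro mult_mono) (auto simp: less_imp_le)
  then show ?case by (simp add: E_add)
qed simp

lemma Fpow_mono:
  assumes "1 \<le> a" "a \<le> a'" "0 \<le> b" "b \<le> b'"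
  shows "Fpow E a b \<le> Fpow E a' b'"
proof -
  have "0 \<le> Flog E a" using Flog_le[of 1 a] assms Flog_E[of 0] by simp
  moreover have "Flog E a \<le> Flog E a'" using Flog_le assms by simp
  ultimately show ?thesis unfolding Fpow_def E_le_iff using assms by (intro mult_mono) auto
qed

lemma Fpow_base_le:
  assumes "2 \<le> a" "2 \<le> b"
  shows "2 * a \<le> Fpow E a b"
proof -
  have "Fpow E a 2 = E (Flog E a) * E (Flog E a)"
    unfolding Fpow_def by (simp add: E_add[symmetric])
  then have "Fpow E a 2 = a * a" using assms by simp
  moreover have "Fpow E a 2 \<le> Fpow E a b" using assms by (intro Fpow_mono) auto
  moreover have "2 * a \<le> a * a" using assms by (intro mult_right_mono) auto
  ultimately show ?thesis by simp
qed

text \<open>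
  A constant strictly below $1$ in front of the power is needed to get below the first term of a
  sequence. With $y = b/6$, the bounds $\log a \ge 1/2$ and $(1+y)^3 \le E(3y)$ reduce the claim
  to $(1 + y)^3 \ge \frac{27}{4} y$, where the left side exceeds the right one by
  $(y - \frac12)^2 (y + 4)$. Squares in place of cubes would only give the constant $1$.
\<close>

lemma Fpow_exponent_le:
  assumes "2 \<le> a" "0 \<le> b"
  shows "9 * b \<le> 8 * Fpow E a b"
proof -
  have "E (b / 2) \<le> Fpow E a b"
    unfolding Fpow_def E_le_iff
    using mult_left_mono[OF Flog_ge_half[OF assms(1)] assms(2)] by simp
  define y where "y = b / 6"
  have y: "0 \<le> y" "b = 6 * y" using assms by (auto simp: y_def)
  have "E (b / 2) = E y * (E y * E y)"
    unfolding E_add[symmetric] y(2) by (simp add: field_simps)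
  moreover have "(1 + y) * ((1 + y) * (1 + y)) \<le> E y * (E y * E y)"
    using E_ge[of y] y by (intro mult_mono) auto
  moreover have "(1 + y) * ((1 + y) * (1 + y)) - 27 * y / 4 = (y - 1 / 2)\<^sup>2 * (y + 4)"
    by (simp add: field_simps power2_eq_square)
  moreover have "0 \<le> (y - 1 / 2)\<^sup>2 * (y + 4)" using y by simp
  ultimately have "27 * y / 4 \<le> Fpow E a b" using \<open>E (b / 2) \<le> Fpow E a b\<close> by linarith
  then show ?thesis using y by simp
qed

text \<open>
  The following lemmas move between a sequence \<open>x\<close> at a scale \<open>e\<close> and the sequence
  \<open>E \<circ> x\<close> at the scale \<open>e * E (x 0)\<close>. For a finite scale, \<open>E (x n)\<close> stays comparable
  with \<open>E (x 0)\<close>, and so the slopes in both tangent inequalities are comparable as well.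
\<close>

lemma bounded_at_log:
  assumes "mono x" "bounded_at (e * E (x 0)) (\<lambda>n. E (x n))"
  shows "bounded_at e x"
proof -
  obtain k :: nat where k: "\<And>n. E (x n) - E (x 0) \<le> of_nat k * (e * E (x 0))"
    using assms unfolding bounded_at_def by blast
  have "x n - x 0 \<le> of_nat k * e" for n
  proof -
    have "E (x 0) * (x n - x 0) \<le> E (x 0) * (of_nat k * e)"
      using order_trans[OF E_tangent k] by (simp add: mult_ac)
    then show ?thesis using E_pos mult_le_cancel_left_pos by blast
  qed
  then show ?thesis unfolding bounded_at_def by blast
qed

lemma E_bounded_ratio:
  assumes "bounded_at e x" "e \<le> of_nat C"
  obtains K :: nat where "\<And>n. E (x n) \<le> of_nat K * E (x 0)"
proof -
  obtain k :: nat where k: "\<And>n. x n - x 0 \<le> of_nat k * e"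
    using assms unfolding bounded_at_def by blast
  have "E (x n) \<le> of_nat (4 ^ (k * C)) * E (x 0)" for n
  proof -
    have "of_nat k * e \<le> of_nat k * of_nat C" using assms(2) by (intro mult_left_mono) auto
    then have "x n - x 0 \<le> of_nat (k * C)" using k[of n] by simp
    then have "E (x n - x 0) \<le> of_nat (4 ^ (k * C))"
      using E_of_nat_le[of "k * C"] E_le_iff order_trans by blast
    then show ?thesis by (simp add: E_diff pos_divide_le_eq)
  qed
  then show thesis using that by blast
qed

lemma bounded_at_exp:
  assumes "mono x" "0 \<le> e" "e \<le> of_nat C" "bounded_at e x"
  shows "bounded_at (e * E (x 0)) (\<lambda>n. E (x n))"
proof -
  obtain k :: nat where k: "\<And>n. x n - x 0 \<le> of_nat k * e"
    using assms unfolding bounded_at_def by blast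
  obtain K :: nat where K: "\<And>n. E (x n) \<le> of_nat K * E (x 0)"
    using E_bounded_ratio[OF assms(4,3)] by blast
  have "E (x n) - E (x 0) \<le> of_nat (K * k) * (e * E (x 0))" for n
  proof -
    have "E (x n) - E (x 0) \<le> E (x n) * (x n - x 0)" by (rule E_tangent')
    also have "\<dots> \<le> (of_nat K * E (x 0)) * (of_nat k * e)"
      using K k monoD[OF assms(1), of 0 n] by (intro mult_mono) (auto simp: less_imp_le)
    finally show ?thesis by (simp add: mult_ac)
  qed
  then show ?thesis unfolding bounded_at_def by blast
qed

lemma settles_at_exp:
  assumes "mono x" "e \<le> of_nat C" "bounded_at e x" "settles_at e x"
  shows "settles_at (e * E (x 0)) (\<lambda>n. E (x n))"
proof -
  obtain K :: nat where K: "\<And>n. E (x n) \<le> of_nat K * E (x 0)"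
    using E_bounded_ratio[OF assms(3,2)] by blast
  obtain N where N: "\<And>m n. N \<le> m \<Longrightarrow> m \<le> n \<Longrightarrow> negligible_at e (x n - x m)"
    using assms(4) unfolding settles_at_def by blast
  have "negligible_at (e * E (x 0)) (E (x n) - E (x m))" if "N \<le> m" "m \<le> n" for m n
  proof (rule negligible_le_mult)
    show "negligible_at (e * E (x 0)) ((x n - x m) * E (x 0))"
      using N that by (intro negligible_scale) (auto simp: less_imp_le)
    have "E (x n) - E (x m) \<le> E (x n) * (x n - x m)" by (rule E_tangent')
    also have "\<dots> \<le> (of_nat K * E (x 0)) * (x n - x m)"
      using K monoD[OF assms(1) that(2)] by (intro mult_right_mono) auto
    finally show "E (x n) - E (x m) \<le> of_nat K * ((x n - x m) * E (x 0))" by (simp add: mult_ac)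
  qed
  then show ?thesis unfolding settles_at_def by blast
qed

lemma settles_at_log:
  assumes "mono x" "settles_at (e * E (x 0)) (\<lambda>n. E (x n))"
  shows "settles_at e x"
proof -
  obtain N where N: "\<And>m n. N \<le> m \<Longrightarrow> m \<le> n \<Longrightarrow> negligible_at (e * E (x 0)) (E (x n) - E (x m))"
    using assms(2) unfolding settles_at_def by blast
  have "negligible_at e (x n - x m)" if "N \<le> m" "m \<le> n" for m n
  proof -
    have le: "x 0 \<le> x m" "x m \<le> x n" using monoD[OF assms(1)] that by auto
    have "(x n - x m) * E (x 0) \<le> (x n - x m) * E (x m)"
      using le by (intro mult_left_mono) auto
    also have "\<dots> \<le> E (x n) - E (x m)" using E_tangent[of "x m" "x n"] by (simp add: mult_ac)
    finally have "negligible_at (e * E (x 0)) ((x n - x m) * E (x 0))"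
      using N that negligible_le by blast
    then have "negligible_at (e * E (x 0) * (1 / E (x 0))) ((x n - x m) * E (x 0) * (1 / E (x 0)))"
      by (rule negligible_scale) (simp add: less_imp_le)
    then show ?thesis by (simp add: less_imp_neq[OF E_pos, symmetric])
  qed
  then show ?thesis unfolding settles_at_def by blast
qed

lemma regular_log_settles:
  assumes A: "mono A" "0 < A 0" "regular A"
    and e: "0 < e" "e \<le> of_nat C" "bounded_at e (\<lambda>n. Flog E (A n))"
  shows "settles_at e (\<lambda>n. Flog E (A n))"
proof -
  let ?x = "\<lambda>n. Flog E (A n)"
  have pos: "0 < A n" for n using A(2) monoD[OF A(1), of 0 n] by simp
  have mx: "mono ?x"
    using monoD[OF A(1)] pos by (intro monoI Flog_le) auto
  have "bounded_at (e * E (?x 0)) (\<lambda>n. E (?x n))"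
    using mx e by (intro bounded_at_exp) auto
  then have "settles_at (e * A 0) A"
    using A(3) e pos by (intro regular_settles) auto
  then have "settles_at (e * E (?x 0)) (\<lambda>n. E (?x n))" using pos by simp
  then show ?thesis by (rule settles_at_log[OF mx])
qed

text \<open>
  Relative to the first value, the scale \<open>d\<close> becomes $e = d / A_0^{B_0}$, which is finite. The
  sequence $\log A_n \cdot B_n$ is then bounded at the scale $e$, and the product lemma applies to
  it because $\log A_0 \cdot B_0 \ge \frac12 \cdot 2$. Regularity of $A$ enters through
  its logarithm at the scale $e / B_0 \le e$.
\<close>

lemma settles_at_Fpow:
  assumes mono: "mono A" "mono B" and ge: "2 \<le> A 0" "2 \<le> B 0" and d: "0 < d"
    and small: "d \<le> of_nat C * Fpow E (A 0) (B 0)"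
    and bdd: "bounded_at d (\<lambda>n. Fpow E (A n) (B n))"
    and reg: "regular A" "regular B"
  shows "settles_at d (\<lambda>n. Fpow E (A n) (B n))"
proof -
  let ?p = "\<lambda>n. Flog E (A n)" and ?x = "\<lambda>n. Flog E (A n) * B n"
  define e where "e = d / E (?x 0)"
  have x: "Fpow E (A n) (B n) = E (?x n)" for n by (simp add: Fpow_def mult.commute)
  have An: "2 \<le> A n" and Bn: "2 \<le> B n" for n
    using ge monoD[OF mono(1), of 0 n] monoD[OF mono(2), of 0 n] by auto
  have p: "1 / 2 \<le> ?p n" for n using Flog_ge_half An by blast
  have p0: "0 < ?p n" for n using p[of n] by (rule less_le_trans[rotated]) simp
  have mp: "mono ?p"
  proof (intro monoI Flog_le)
    fix m n :: nat assume "m \<le> n"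
    then show "A m \<le> A n" using monoD[OF mono(1)] by blast
    show "0 < A m" using An[of m] by simp
  qed
  have mx: "mono ?x"
  proof (intro monoI mult_mono)
    fix m n :: nat assume "m \<le> n"
    then show "?p m \<le> ?p n" "B m \<le> B n" using monoD mp mono by blast+
    show "0 \<le> ?p n" "0 \<le> B m" using p0[of n] Bn[of m] by auto
  qed
  have e: "0 < e" "e \<le> of_nat C" "d = e * E (?x 0)"
    using d small unfolding e_def x by (auto simp: pos_divide_le_eq less_imp_neq[OF E_pos, symmetric])
  have bx: "bounded_at e ?x" using bounded_at_log[OF mx] bdd e(3) x by simp
  have "settles_at e ?x"
  proof (rule settles_at_product[OF mp mono(2)])
    show "0 < ?p 0" "0 < B 0" "0 < e" using p0 Bn[of 0] e by auto
    have "1 / 2 * 2 \<le> ?p 0 * B 0" using p[of 0] Bn[of 0] by (intro mult_mono) auto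
    then have "of_nat C * 1 \<le> of_nat C * (?p 0 * B 0)" by (intro mult_left_mono) auto
    then show "e \<le> of_nat C * (?p 0 * B 0)" using e by simp
    show "bounded_at e ?x" by fact
    assume "bounded_at (e / B 0) ?p"
    moreover have "e / B 0 \<le> e" using e Bn[of 0] by (simp add: pos_divide_le_eq)
    moreover have "0 < e / B 0" "0 < A 0" using e Bn[of 0] An[of 0] by auto
    ultimately show "settles_at (e / B 0) ?p"
      using mono(1) reg(1) e by (intro regular_log_settles[where C = C]) auto
  next
    assume "bounded_at (e / ?p 0) B"
    then show "settles_at (e / ?p 0) B" using reg(2) e p0 by (intro regular_settles) auto
  qed
  then show ?thesis using settles_at_exp[OF mx e(2) bx] e(3) x by simp
qed

end

section \<open>The values of Skolem terms\<close>

locale skolem_values = exponential_field E for E :: "'a::linordered_field \<Rightarrow> 'a" +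
  fixes X :: 'a
  assumes X_ge: "2 \<le> X"
begin

definition V :: "'a set" where
  "V = range (skterm_at E X)"

lemma V_one: "1 \<in> V" and V_X: "X \<in> V"
  and V_add: "\<And>a b. a \<in> V \<Longrightarrow> b \<in> V \<Longrightarrow> a + b \<in> V"
  and V_mult: "\<And>a b. a \<in> V \<Longrightarrow> b \<in> V \<Longrightarrow> a * b \<in> V"
  and V_pow: "\<And>a b. a \<in> V \<Longrightarrow> b \<in> V \<Longrightarrow> Fpow E a b \<in> V"
proof -
  show "1 \<in> V" unfolding V_def by (rule range_eqI[of _ _ SkOne]) simp
  show "X \<in> V" unfolding V_def by (rule range_eqI[of _ _ SkId]) simp
  fix a b assume "a \<in> V" "b \<in> V"
  then obtain s t where st: "a = skterm_at E X s" "b = skterm_at E X t" unfolding V_def by blast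
  show "a + b \<in> V" unfolding V_def st by (rule range_eqI[of _ _ "SkAdd s t"]) simp
  show "a * b \<in> V" unfolding V_def st by (rule range_eqI[of _ _ "SkMul s t"]) simp
  show "Fpow E a b \<in> V" unfolding V_def st by (rule range_eqI[of _ _ "SkPow s t"]) simp
qed

lemma Fpow_1_left [simp]: "Fpow E 1 b = 1"
  using Flog_E[of 0] by (simp add: Fpow_def)

lemma Fpow_1_right [simp]: "0 < a \<Longrightarrow> Fpow E a 1 = a"
  by (simp add: Fpow_def)

lemma value_1_or_ge_2: "skterm_at E X t = 1 \<or> 2 \<le> skterm_at E X t"
proof (induction t)
  case (SkAdd s t)
  then show ?case by auto
next
  case (SkMul s t)
  have "2 * 1 \<le> a * b" if "2 \<le> a" "2 \<le> b" for a b :: 'a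
    using that by (intro mult_mono) auto
  then show ?case using SkMul by auto
next
  case (SkPow s t)
  have "2 \<le> Fpow E a b" if "2 \<le> a" "2 \<le> b" for a b
    using that Fpow_base_le[of a b] by simp
  then show ?case using SkPow by auto
qed (use X_ge in auto)

lemma value_ge_1: "1 \<le> skterm_at E X t"
  using value_1_or_ge_2[of t] by auto

lemma V_ge_1: "a \<in> V \<Longrightarrow> 1 \<le> a"
  using value_ge_1 unfolding V_def by blast

lemma value_pow_1 [simp]: "Fpow E (skterm_at E X t) 1 = skterm_at E X t"
  using value_ge_1[of t] by (intro Fpow_1_right) simp

definition descending :: "'a set" where
  "descending = {v \<in> V. \<exists>g. g 0 = v \<and> (\<forall>n. g n \<in> V \<and> g (Suc n) < g n)}"

lemma descending_next:
  assumes "v \<in> descending"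
  obtains w where "w \<in> descending" "w < v"
proof -
  obtain g where g: "g 0 = v" "\<And>n. g n \<in> V" "\<And>n. g (Suc n) < g n"
    using assms unfolding descending_def by blast
  then have "g 1 \<in> descending"
    unfolding descending_def by (auto intro!: exI[of _ "\<lambda>n. g (Suc n)"])
  then show thesis using that[of "g 1"] g(1) g(3)[of 0] by simp
qed

lemma well_ordered_no_descent:
  assumes "\<And>g::nat \<Rightarrow> 'a. (\<forall>n. g n \<in> A) \<Longrightarrow> \<exists>n. g n \<le> g (Suc n)"
  shows "well_ordered A"
  unfolding well_ordered_def
proof (intro allI impI, rule ccontr)
  fix B assume B: "B \<subseteq> A" "B \<noteq> {}" and no: "\<not> (\<exists>z\<in>B. \<forall>y\<in>B. z \<le> y)"
  then obtain b where b: "b \<in> B" by blast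
  have "\<exists>g. \<forall>n. g n \<in> B \<and> g (Suc n) < g n"
  proof (rule dependent_nat_choice)
    show "\<exists>x. x \<in> B" using b by blast
    show "\<exists>y. y \<in> B \<and> y < x" if "x \<in> B" for x using no that by (auto simp: not_le)
  qed
  then obtain g where "\<And>n. g n \<in> B" "\<And>n. g (Suc n) < g n" by blast
  then show False using assms[of g] B(1) by (metis leD subsetD)
qed

lemma well_ordered_V_minus_descending: "well_ordered (V - descending)"
proof (rule well_ordered_no_descent, rule ccontr)
  fix g :: "nat \<Rightarrow> 'a" assume g: "\<forall>n. g n \<in> V - descending" and "\<not> (\<exists>n. g n \<le> g (Suc n))"
  then have "g 0 \<in> descending" unfolding descending_def by (auto simp: not_le)
  then show False using g by blast
qed

fun immediate_subterms :: "skterm \<Rightarrow> skterm list" where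
  "immediate_subterms (SkAdd s t) = [s, t]"
| "immediate_subterms (SkMul s t) = [s, t]"
| "immediate_subterms (SkPow s t) = [s, t]"
| "immediate_subterms _ = []"

lemma immediate_subterms_smaller:
  "s \<in> set (immediate_subterms t) \<Longrightarrow> size s < size t"
  by (cases t) auto

text \<open>
  The exceptional case is $1^b = 1$, which may be smaller than its exponent.
\<close>

lemma immediate_subterms_le: "s \<in> set (immediate_subterms t) \<Longrightarrow>
    skterm_at E X s \<le> skterm_at E X t \<or> skterm_at E X t = 1"
proof (cases t)
  case (SkAdd a b)
  assume "s \<in> set (immediate_subterms t)"
  then show ?thesis using SkAdd value_ge_1[of a] value_ge_1[of b] by auto
next
  case (SkMul a b)
  have "u \<le> u * v" "v \<le> u * v" if "1 \<le> u" "1 \<le> v" for u v :: 'a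
    using that mult_left_mono[of 1 v u] mult_right_mono[of 1 u v] by auto
  moreover assume "s \<in> set (immediate_subterms t)"
  ultimately show ?thesis using SkMul value_ge_1[of a] value_ge_1[of b] by auto
next
  case (SkPow a b)
  assume s: "s \<in> set (immediate_subterms t)"
  consider "skterm_at E X a = 1" | "2 \<le> skterm_at E X a" using value_1_or_ge_2 by blast
  then show ?thesis
  proof cases
    case 2
    let ?u = "skterm_at E X a" and ?v = "skterm_at E X b"
    have "?u \<le> Fpow E ?u ?v"
      using Fpow_mono[of ?u ?u 1 ?v] value_ge_1[of a] value_ge_1[of b] by simp
    moreover have "?v \<le> Fpow E ?u ?v"
      using Fpow_exponent_le[of ?u ?v] 2 value_ge_1[of b] by simp
    ultimately show ?thesis using s SkPow by auto
  qed (use SkPow in auto)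
qed auto

text \<open>
  Starting from a descent, terms $t_0, t_1, \dots$ are chosen one after the other, each of least
  size among the terms whose value lies below the value of the previous one and still starts an
  infinite descent. An argument of $t_{n+1}$ has a value below that of $t_n$ and smaller size, so
  it starts no descent, by minimality. The arguments therefore take values in the
  well-ordered set \<open>V - descending\<close>, where sequences have nondecreasing subsequences. As
  the operations are monotone, infinitely many terms with the same head symbol cannot have
  decreasing values. This is the minimal bad sequence argument for Kruskal's theorem, simplified by
  the order being total.
\<close>

theorem well_ordered_V: "well_ordered V"
proof (rule ccontr)
  let ?v = "skterm_at E X"
  assume "\<not> well_ordered V"
  then obtain g :: "nat \<Rightarrow> 'a" where "\<And>n. g n \<in> V" "\<And>n. g (Suc n) < g n"
    using well_ordered_no_descent[of V] not_le by metis
  then have g0: "g 0 \<in> descending" unfolding descending_def by blast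
  define minimal_below where "minimal_below = (\<lambda>b t. ?v t \<in> descending \<and> ?v t < b \<and>
      (\<forall>s. ?v s \<in> descending \<and> ?v s < b \<longrightarrow> size t \<le> size s))"
  have minimal_below_ex: "\<exists>t. minimal_below b t" if "v \<in> descending" "v < b" for v b
  proof -
    have "v \<in> V" using that(1) unfolding descending_def by blast
    then obtain t where "v = ?v t" unfolding V_def by (rule rangeE)
    then show ?thesis unfolding minimal_below_def
      using ex_has_least_nat[of "\<lambda>t. ?v t \<in> descending \<and> ?v t < b" t size] that by auto
  qed
  \<comment> \<open>\<open>minimal_below b t\<close> for some \<open>b\<close> is only carried along to know that \<open>t\<close> starts a descent.\<close>
  have "\<exists>t. \<forall>n. (\<exists>b. minimal_below b (t n)) \<and> minimal_below (?v (t n)) (t (Suc n))"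
  proof (rule dependent_nat_choice)
    show "\<exists>t. \<exists>b. minimal_below b t" using minimal_below_ex[OF g0, of "g 0 + 1"] by auto
    fix t and n :: nat assume "\<exists>b. minimal_below b t"
    then have "?v t \<in> descending" unfolding minimal_below_def by blast
    then obtain w where "w \<in> descending" "w < ?v t" by (rule descending_next)
    then show "\<exists>s. (\<exists>b. minimal_below b s) \<and> minimal_below (?v t) s" using minimal_below_ex by blast
  qed
  then obtain t where t: "\<And>n. minimal_below (?v (t n)) (t (Suc n))" by blast
  \<comment> \<open>\<open>t 0\<close> is dropped because it was not chosen below an earlier value of the sequence.\<close>
  define u where "u = (\<lambda>n. t (Suc n))"
  have dec: "?v (u (Suc n)) < ?v (u n)" for n
    using t unfolding u_def minimal_below_def by blast
  have less: "?v (u n) < ?v (u m)" if "m < n" for m n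
    using lift_Suc_mono_less[of "\<lambda>n. - ?v (u n)", OF _ that] dec by simp
  have desc: "?v (u n) \<in> descending" for n
    using t unfolding u_def minimal_below_def by blast
  have ne1: "?v (u n) \<noteq> 1" for n
    using dec[of n] value_ge_1[of "u (Suc n)"] by auto
  have args: "?v s \<in> V - descending" if s: "s \<in> set (immediate_subterms (u n))" for n s
  proof -
    have "?v s \<le> ?v (u n)" using immediate_subterms_le[OF s] ne1 by auto
    also have "?v (u n) < ?v (t n)" using t unfolding u_def minimal_below_def by blast
    finally have "?v s < ?v (t n)" .
    then have "?v s \<notin> descending"
      using t[of n] immediate_subterms_smaller[OF s] unfolding u_def minimal_below_def by fastforce
    then show ?thesis unfolding V_def by blast
  qed
  have no_op: False if ex: "\<exists>\<^sub>\<infinity>n. \<exists>a b. u n = f a b"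
    and sub: "\<And>a b. immediate_subterms (f a b) = [a, b]"
    and mono: "\<And>a b a' b'. ?v a \<le> ?v a' \<Longrightarrow> ?v b \<le> ?v b' \<Longrightarrow> ?v (f a b) \<le> ?v (f a' b')" for f
  proof -
    obtain \<sigma> :: "nat \<Rightarrow> nat" and a b where "strict_mono \<sigma> \<and> (\<forall>n. u (\<sigma> n) = f (a n) (b n))"
      using infinitely_often_choice[OF ex] by (elim exE) (erule that)
    then have \<sigma>: "strict_mono \<sigma>" and ab: "\<And>n. u (\<sigma> n) = f (a n) (b n)" by auto
    have "?v (a n) \<in> V - descending" "?v (b n) \<in> V - descending" for n
      using args[of _ "\<sigma> n"] ab sub by auto
    then obtain \<rho> :: "nat \<Rightarrow> nat" where \<rho>: "strict_mono \<rho>" "mono ((\<lambda>n. ?v (a n)) \<circ> \<rho>)" "mono ((\<lambda>n. ?v (b n)) \<circ> \<rho>)"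
      using mono_subseq2[OF well_ordered_V_minus_descending, of "\<lambda>n. ?v (a n)" "\<lambda>n. ?v (b n)"]
      by blast
    have "?v (u (\<sigma> (\<rho> 0))) \<le> ?v (u (\<sigma> (\<rho> 1)))"
      using mono[of "a (\<rho> 0)" "a (\<rho> 1)" "b (\<rho> 0)" "b (\<rho> 1)"]
        monoD[OF \<rho>(2), of 0 1] monoD[OF \<rho>(3), of 0 1] ab[of "\<rho> 0"] ab[of "\<rho> 1"] by simp
    moreover have "\<sigma> (\<rho> 0) < \<sigma> (\<rho> 1)" using \<sigma> \<rho>(1) by (simp add: strict_mono_def)
    ultimately show False using less by (meson leD)
  qed
  have "(\<exists>\<^sub>\<infinity>n. u n = SkOne) \<or> (\<exists>\<^sub>\<infinity>n. u n = SkId) \<or> (\<exists>\<^sub>\<infinity>n. \<exists>a b. u n = SkAdd a b) \<or>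
      (\<exists>\<^sub>\<infinity>n. \<exists>a b. u n = SkMul a b) \<or> (\<exists>\<^sub>\<infinity>n. \<exists>a b. u n = SkPow a b)"
  proof -
    have "u n = SkOne \<or> u n = SkId \<or> (\<exists>a b. u n = SkAdd a b) \<or>
        (\<exists>a b. u n = SkMul a b) \<or> (\<exists>a b. u n = SkPow a b)" for n
      by (cases "u n") auto
    then have "\<exists>\<^sub>\<infinity>n. u n = SkOne \<or> u n = SkId \<or> (\<exists>a b. u n = SkAdd a b) \<or>
        (\<exists>a b. u n = SkMul a b) \<or> (\<exists>a b. u n = SkPow a b)"
      by (intro MOST_INFM[OF infinite_UNIV_nat] MOST_I)
    then show ?thesis unfolding frequently_disj_iff .
  qed
  moreover have "\<not> (\<exists>\<^sub>\<infinity>n. u n = s)" for s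
  proof
    assume "\<exists>\<^sub>\<infinity>n. u n = s"
    then obtain \<sigma> :: "nat \<Rightarrow> nat" where \<sigma>: "strict_mono \<sigma>" "\<And>n. u (\<sigma> n) = s"
      using infinitely_often_subseq by blast
    then have "\<sigma> 0 < \<sigma> 1" by (simp add: strict_mono_def)
    from less[OF this] show False using \<sigma>(2) by simp
  qed
  moreover have "\<not> (\<exists>\<^sub>\<infinity>n. \<exists>a b. u n = SkAdd a b)"
    by (intro notI, erule no_op) (auto intro: add_mono)
  moreover have "\<not> (\<exists>\<^sub>\<infinity>n. \<exists>a b. u n = SkMul a b)"
  proof (intro notI, erule no_op)
    fix a b a' b' assume "?v a \<le> ?v a'" "?v b \<le> ?v b'"
    then show "?v (SkMul a b) \<le> ?v (SkMul a' b')"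
      using value_ge_1[of a'] value_ge_1[of b] by (auto intro: mult_mono)
  qed simp
  moreover have "\<not> (\<exists>\<^sub>\<infinity>n. \<exists>a b. u n = SkPow a b)"
  proof (intro notI, erule no_op)
    fix a b a' b' assume "?v a \<le> ?v a'" "?v b \<le> ?v b'"
    then show "?v (SkPow a b) \<le> ?v (SkPow a' b')"
      using value_ge_1[of a] value_ge_1[of b] by (auto intro: Fpow_mono)
  qed simp
  ultimately show False by blast
qed

section \<open>Every monotone sequence of values is regular\<close>

text \<open>
  The second summand of a splitting may be missing; zero stands for it, so that
  the second summands of a sequence always form a sequence themselves.
\<close>

abbreviation V0 :: "'a set" where
  "V0 \<equiv> insert 0 V"

lemma well_ordered_V0: "well_ordered V0"
  using well_ordered_V
proof (rule well_ordered_insert)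
  show "0 < a" if "a \<in> V" for a using V_ge_1[OF that] by simp
qed

lemma V0_nonneg: "a \<in> V0 \<Longrightarrow> 0 \<le> a"
  using V_ge_1[of a] by auto

lemma V_V0_add: "a \<in> V \<Longrightarrow> b \<in> V0 \<Longrightarrow> a + b \<in> V"
  using V_add by auto

text \<open>
  Demanding that both arguments be at least $2$ guarantees that they are smaller than the product
  or power by a fixed factor. The degenerate cases $1 \cdot b$, $a \cdot 1$, $1^b$ and $a^1$ reduce to
  an argument or to $1$.
\<close>

definition piece :: "'a \<Rightarrow> bool" where
  "piece u \<longleftrightarrow> u \<in> {1, X} \<or> (\<exists>a\<in>V. \<exists>b\<in>V. 2 \<le> a \<and> 2 \<le> b \<and> u \<in> {a * b, Fpow E a b})"

lemma piece_in_V: "piece u \<Longrightarrow> u \<in> V"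
  unfolding piece_def using V_one V_X V_mult V_pow by auto

inductive_set piece_sums :: "'a set" where
  piece: "piece u \<Longrightarrow> u \<in> piece_sums"
| add: "u \<in> piece_sums \<Longrightarrow> v \<in> piece_sums \<Longrightarrow> u + v \<in> piece_sums"

lemma value_in_piece_sums: "skterm_at E X t \<in> piece_sums"
proof (induction t)
  case SkOne
  have "piece 1" unfolding piece_def by blast
  then show ?case by (simp add: piece_sums.piece)
next
  case SkId
  have "piece X" unfolding piece_def by blast
  then show ?case by (simp add: piece_sums.piece)
next
  case (SkAdd s t)
  then show ?case by (simp add: piece_sums.add)
next
  case (SkMul s t)
  consider "skterm_at E X s = 1" | "skterm_at E X t = 1"
    | "2 \<le> skterm_at E X s" "2 \<le> skterm_at E X t" using value_1_or_ge_2 by blast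
  then show ?case
  proof cases
    case 3
    then have "piece (skterm_at E X (SkMul s t))" unfolding piece_def V_def by auto
    then show ?thesis by (rule piece_sums.piece)
  qed (use SkMul in auto)
next
  case (SkPow s t)
  consider "skterm_at E X s = 1" | "skterm_at E X t = 1"
    | "2 \<le> skterm_at E X s" "2 \<le> skterm_at E X t" using value_1_or_ge_2 by blast
  then show ?case
  proof cases
    case 3
    then have "piece (skterm_at E X (SkPow s t))" unfolding piece_def V_def by auto
    then show ?thesis by (rule piece_sums.piece)
  qed (use SkPow in auto)
qed

lemma piece_sums_eq_V: "piece_sums = V"
proof
  show "piece_sums \<subseteq> V"
  proof
    fix u assume "u \<in> piece_sums"
    then show "u \<in> V" by induction (auto intro: piece_in_V V_add)
  qed
  show "V \<subseteq> piece_sums" unfolding V_def using value_in_piece_sums by blast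
qed

definition splits :: "'a \<Rightarrow> 'a \<Rightarrow> 'a \<Rightarrow> bool" where
  "splits u g h \<longleftrightarrow> u = g + h \<and> g \<in> V \<and> h \<in> V0 \<and> 3 * h \<le> 2 * u \<and> (3 * g \<le> 2 * u \<or> piece g)"

text \<open>
  Descend into the larger summand as long as it keeps more than two thirds of the total
  $s + h$, collecting what is left behind in $h$, which thus stays at most one third. The descent ends
  either at a piece or at a summand with at most two thirds; that summand has at least one third, as
  the larger half of two thirds, and so its complement has at most two thirds too.
\<close>

lemma piece_sums_split:
  assumes "s \<in> piece_sums" "h \<in> V0" "3 * h \<le> s + h"
  shows "\<exists>g h'. splits (s + h) g h'"
  using assms
proof (induction arbitrary: h)
  case (piece s)
  have "splits (s + h) s h"
    using piece V0_nonneg[of h] piece_in_V V_ge_1[of s] unfolding splits_def by auto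
  then show ?case by blast
next
  case (add s t)
  have main: "\<exists>g h'. splits (s + t + h) g h'" if st: "s \<in> V" "t \<in> V" "t \<le> s"
    and IH: "\<And>h. h \<in> V0 \<Longrightarrow> 3 * h \<le> s + h \<Longrightarrow> \<exists>g h'. splits (s + h) g h'"
    and u: "3 * h \<le> s + t + h" for s t
  proof (cases "3 * s \<le> 2 * (s + t + h)")
    case True
    then have "splits (s + t + h) s (t + h)"
      using st u V_V0_add[of t h] add.prems(1) unfolding splits_def by (simp add: algebra_simps)
    then show ?thesis by blast
  next
    case False
    then have "\<exists>g h'. splits (s + (t + h)) g h'"
      using V_V0_add[of t h] st add.prems(1) by (intro IH) auto
    then show ?thesis by (simp add: add.assoc)
  qed
  have V: "s \<in> V" "t \<in> V" using add.hyps piece_sums_eq_V by auto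
  show ?case
  proof (cases "t \<le> s")
    case True
    then show ?thesis using main[OF V _ add.IH(1) add.prems(2)] by simp
  next
    case False
    have "t + s + h = s + t + h" by (simp add: add.commute)
    moreover have "\<exists>g h'. splits (t + s + h) g h'"
    proof (rule main[OF V(2,1) _ add.IH(2)])
      show "s \<le> t" using False by simp
      show "3 * h \<le> t + s + h" using add.prems(2) by (simp add: add.commute[of t s])
    qed
    ultimately show ?thesis by (simp only:)
  qed
qed

lemma V_split:
  assumes "u \<in> V"
  obtains g h where "splits u g h"
proof -
  have "0 \<le> u" using V_ge_1[OF assms] by simp
  then have "\<exists>g h. splits (u + 0) g h"
    using assms piece_sums_eq_V by (intro piece_sums_split) simp_all
  then show thesis using that by auto
qed

text \<open>
  Infinitely many terms of the sequence are of the same kind. Constant subsequences settle; for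
  products and powers the arguments have nondecreasing subsequences lying below \<open>b\<close>, and these are
  regular by hypothesis.
\<close>

lemma piece_settles:
  assumes bnd: "\<And>f. mono f \<Longrightarrow> (\<And>n. f n \<in> V) \<Longrightarrow> (\<And>n. f n < b) \<Longrightarrow> regular f"
    and g: "mono g" "\<And>n. piece (g n)" "\<And>n. 16 * g n \<le> 17 * b"
    and d: "0 < d" "d \<le> of_nat C * g 0" "bounded_at d g"
  shows "settles_at d g"
proof -
  have "0 < g 0" using piece_in_V[OF g(2)] V_ge_1 less_le_trans[OF zero_less_one] by blast
  have b: "0 < b" using g(3)[of 0] \<open>0 < g 0\<close> by simp
  have d_sub: "d \<le> of_nat C * g (\<sigma> 0)" for \<sigma> :: "nat \<Rightarrow> nat"
    using d(2) mult_left_mono[OF monoD[OF g(1)], of 0 "\<sigma> 0" "of_nat C"] by simp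
  have const: "settles_at d g" if inf: "\<exists>\<^sub>\<infinity>n. g n = a" for a
  proof -
    obtain \<sigma> :: "nat \<Rightarrow> nat" where \<sigma>: "strict_mono \<sigma>" "\<And>n. g (\<sigma> n) = a"
      using infinitely_often_subseq[OF inf] by blast
    then have "settles_at d (g \<circ> \<sigma>)" using settles_at_const[of d a] d(1) by (simp add: o_def)
    then show ?thesis using settles_at_subseq g(1) \<sigma>(1) by blast
  qed
  have op: "settles_at d g"
    if inf: "\<exists>\<^sub>\<infinity>n. \<exists>x y. x \<in> V \<and> y \<in> V \<and> 2 \<le> x \<and> 2 \<le> y \<and> g n = f x y"
      and sub: "\<And>x y. 2 \<le> x \<Longrightarrow> 2 \<le> y \<Longrightarrow> 9 * x \<le> 8 * f x y \<and> 9 * y \<le> 8 * f x y"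
      and settles: "\<And>p q. mono p \<Longrightarrow> mono q \<Longrightarrow> 2 \<le> p 0 \<Longrightarrow> 2 \<le> q 0 \<Longrightarrow>
        d \<le> of_nat C * f (p 0) (q 0) \<Longrightarrow> bounded_at d (\<lambda>n. f (p n) (q n)) \<Longrightarrow>
        regular p \<Longrightarrow> regular q \<Longrightarrow> settles_at d (\<lambda>n. f (p n) (q n))" for f
  proof -
    obtain \<sigma> :: "nat \<Rightarrow> nat" and p q where "strict_mono \<sigma> \<and> (\<forall>n. p n \<in> V \<and> q n \<in> V \<and> 2 \<le> p n \<and> 2 \<le> q n \<and>
        g (\<sigma> n) = f (p n) (q n))"
      using infinitely_often_choice[OF inf] by (elim exE) (erule that)
    then have \<sigma>: "strict_mono \<sigma>" and
      pq: "\<And>n. p n \<in> V" "\<And>n. q n \<in> V" "\<And>n. 2 \<le> p n" "\<And>n. 2 \<le> q n"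
      "\<And>n. g (\<sigma> n) = f (p n) (q n)" by auto
    obtain \<rho> :: "nat \<Rightarrow> nat" where \<rho>: "strict_mono \<rho>" "mono (p \<circ> \<rho>)" "mono (q \<circ> \<rho>)"
      using mono_subseq2[OF well_ordered_V, of p q] pq(1,2) by blast
    have less: "p n < b" "q n < b" for n
      using sub[OF pq(3,4), of n n] g(3)[of "\<sigma> n"] b unfolding pq(5) by linarith+
    have "settles_at d (\<lambda>n. f ((p \<circ> \<rho>) n) ((q \<circ> \<rho>) n))"
    proof (rule settles[OF \<rho>(2,3)])
      show "2 \<le> (p \<circ> \<rho>) 0" "2 \<le> (q \<circ> \<rho>) 0" using pq by auto
      show "d \<le> of_nat C * f ((p \<circ> \<rho>) 0) ((q \<circ> \<rho>) 0)"
        using d_sub[of "\<sigma> \<circ> \<rho>"] pq(5) by simp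
      show "bounded_at d (\<lambda>n. f ((p \<circ> \<rho>) n) ((q \<circ> \<rho>) n))"
        using bounded_at_subseq[OF g(1) d(3), of "\<sigma> \<circ> \<rho>"] pq(5) by (simp add: o_def)
      show "regular (p \<circ> \<rho>)" "regular (q \<circ> \<rho>)" using \<rho> pq less by (auto intro!: bnd)
    qed
    then have "settles_at d (g \<circ> (\<sigma> \<circ> \<rho>))" using pq(5) by (simp add: o_def)
    moreover have "strict_mono (\<sigma> \<circ> \<rho>)" using \<sigma> \<rho>(1) by (simp add: strict_mono_def)
    ultimately show ?thesis using settles_at_subseq g(1) by blast
  qed
  have "\<exists>\<^sub>\<infinity>n. g n = 1 \<or> g n = X \<or> (\<exists>x y. x \<in> V \<and> y \<in> V \<and> 2 \<le> x \<and> 2 \<le> y \<and> g n = x * y) \<or>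
      (\<exists>x y. x \<in> V \<and> y \<in> V \<and> 2 \<le> x \<and> 2 \<le> y \<and> g n = Fpow E x y)"
    using g(2) unfolding piece_def by (intro MOST_INFM[OF infinite_UNIV_nat] MOST_I) blast
  then consider "\<exists>\<^sub>\<infinity>n. g n = 1" | "\<exists>\<^sub>\<infinity>n. g n = X"
    | "\<exists>\<^sub>\<infinity>n. \<exists>x y. x \<in> V \<and> y \<in> V \<and> 2 \<le> x \<and> 2 \<le> y \<and> g n = x * y"
    | "\<exists>\<^sub>\<infinity>n. \<exists>x y. x \<in> V \<and> y \<in> V \<and> 2 \<le> x \<and> 2 \<le> y \<and> g n = Fpow E x y"
    unfolding frequently_disj_iff by blast
  then show ?thesis
  proof cases
    case 3
    then show ?thesis
    proof (rule op)
      show "9 * x \<le> 8 * (x * y) \<and> 9 * y \<le> 8 * (x * y)" if "2 \<le> x" "2 \<le> y" for x y :: 'a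
        using mult_left_mono[of 2 y x] mult_right_mono[of 2 x y] that by auto
      show "settles_at d (\<lambda>n. p n * q n)"
        if "mono p" "mono q" "2 \<le> p 0" "2 \<le> q 0" "d \<le> of_nat C * (p 0 * q 0)"
          "bounded_at d (\<lambda>n. p n * q n)" "regular p" "regular q" for p q
        using that d(1) by (intro settles_at_product) (auto intro: regular_settles)
    qed
  next
    case 4
    then show ?thesis
    proof (rule op)
      show "9 * x \<le> 8 * Fpow E x y \<and> 9 * y \<le> 8 * Fpow E x y" if "2 \<le> x" "2 \<le> y" for x y
        using Fpow_base_le[of x y] Fpow_exponent_le[of x y] that by auto
    qed (use d(1) settles_at_Fpow in blast)
  qed (use const in blast)+
qed

text \<open>
  The induction step. In a splitting $f_n = g_n + h_n$ all small parts are at most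
  $\frac23 f_n \le \frac23 \cdot \frac{17}{16} f_0 < f_0$, hence regular. When $g_n$ is a piece it
  is at least $\frac13 f_n$, so that \<open>d\<close> is not large compared with it either.
\<close>

lemma regular_step:
  assumes bnd: "\<And>g. mono g \<Longrightarrow> (\<And>n. g n \<in> V0) \<Longrightarrow> (\<And>n. g n < f 0) \<Longrightarrow> regular g"
    and f: "mono f" "\<And>n. f n \<in> V" "\<And>n. 16 * f n \<le> 17 * f 0"
    and d: "0 < d" "d \<le> of_nat C * f 0" "bounded_at d f"
  shows "settles_at d f"
proof -
  have "\<exists>g h. splits (f n) g h" for n using V_split[OF f(2)] by metis
  then obtain g h where gh: "\<And>n. splits (f n) (g n) (h n)" by metis
  then have V0: "g n \<in> V0" "h n \<in> V0" for n unfolding splits_def by auto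
  obtain \<sigma> :: "nat \<Rightarrow> nat" where \<sigma>: "strict_mono \<sigma>" "mono (g \<circ> \<sigma>)" "mono (h \<circ> \<sigma>)"
    using mono_subseq2[OF well_ordered_V0, of g h] V0 by blast
  have f\<sigma>: "f \<circ> \<sigma> = (\<lambda>n. (g \<circ> \<sigma>) n + (h \<circ> \<sigma>) n)"
    using gh unfolding splits_def by auto
  have pos: "0 < f 0" using f(2)[of 0] V_ge_1[of "f 0"] less_le_trans[OF zero_less_one] by blast
  have small: "u < f 0" if "3 * u \<le> 2 * f n" for u n
    using that f(3)[of n] pos by linarith
  have sum: "bounded_at d (\<lambda>n. (g \<circ> \<sigma>) n + (h \<circ> \<sigma>) n)"
    using bounded_at_subseq[OF f(1) d(3), of \<sigma>] unfolding f\<sigma> .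
  then have bg: "bounded_at d (g \<circ> \<sigma>)" using \<sigma>(3) by (rule bounded_at_summand)
  have bh: "bounded_at d (h \<circ> \<sigma>)"
    using sum \<sigma>(2) by (intro bounded_at_summand[of d "h \<circ> \<sigma>" "g \<circ> \<sigma>"]) (simp_all add: add.commute)
  have "regular (h \<circ> \<sigma>)"
  proof (rule bnd)
    show "(h \<circ> \<sigma>) n < f 0" for n
      using gh[of "\<sigma> n"] small[of "h (\<sigma> n)" "\<sigma> n"] unfolding splits_def by simp
  qed (use \<sigma>(3) V0 in auto)
  then have "settles_at d (h \<circ> \<sigma>)" using d(1) bh by (rule regular_settles)
  moreover have "settles_at d (g \<circ> \<sigma>)"
  proof -
    have "\<exists>\<^sub>\<infinity>n. 3 * g (\<sigma> n) \<le> 2 * f (\<sigma> n) \<or> piece (g (\<sigma> n))"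
      using gh unfolding splits_def by (intro MOST_INFM[OF infinite_UNIV_nat] MOST_I) blast
    then consider "\<exists>\<^sub>\<infinity>n. 3 * g (\<sigma> n) \<le> 2 * f (\<sigma> n)" | "\<exists>\<^sub>\<infinity>n. piece (g (\<sigma> n))"
      unfolding frequently_disj_iff by blast
    then show ?thesis
    proof cases
      case 1
      then obtain \<rho> :: "nat \<Rightarrow> nat" where \<rho>: "strict_mono \<rho>" "\<And>n. 3 * g (\<sigma> (\<rho> n)) \<le> 2 * f (\<sigma> (\<rho> n))"
        using infinitely_often_subseq[OF 1] by blast
      have mono: "mono (g \<circ> \<sigma> \<circ> \<rho>)"
        using \<sigma>(2) \<rho>(1) by (simp add: mono_def strict_mono_less_eq)
      have "regular (g \<circ> \<sigma> \<circ> \<rho>)"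
      proof (rule bnd)
        show "(g \<circ> \<sigma> \<circ> \<rho>) n < f 0" for n using small[OF \<rho>(2), of n] by simp
      qed (use mono V0 in auto)
      then have "settles_at d (g \<circ> \<sigma> \<circ> \<rho>)"
        using d(1) bounded_at_subseq[OF \<sigma>(2) bg] by (rule regular_settles)
      then show ?thesis using settles_at_subseq[OF \<sigma>(2) \<rho>(1)] by blast
    next
      case 2
      then obtain \<rho> :: "nat \<Rightarrow> nat" where \<rho>: "strict_mono \<rho>" "\<And>n. piece (g (\<sigma> (\<rho> n)))"
        using infinitely_often_subseq[OF 2] by blast
      have mono: "mono (g \<circ> \<sigma> \<circ> \<rho>)"
        using \<sigma>(2) \<rho>(1) by (simp add: mono_def strict_mono_less_eq)
      have "settles_at d (g \<circ> \<sigma> \<circ> \<rho>)"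
      proof (rule piece_settles[where b = "f 0" and C = "3 * C"])
        show "regular f'" if "mono f'" "\<And>n. f' n \<in> V" "\<And>n. f' n < f 0" for f'
          using that by (intro bnd) auto
        show "piece ((g \<circ> \<sigma> \<circ> \<rho>) n)" for n using \<rho>(2) by simp
        show "16 * (g \<circ> \<sigma> \<circ> \<rho>) n \<le> 17 * f 0" for n
          using f(3)[of "\<sigma> (\<rho> n)"] gh[of "\<sigma> (\<rho> n)"] V0_nonneg[OF V0(2), of "\<sigma> (\<rho> n)"]
          unfolding splits_def by simp
        have "f 0 \<le> f (\<sigma> (\<rho> 0))" using monoD[OF f(1)] by blast
        then have "f 0 \<le> 3 * g (\<sigma> (\<rho> 0))"
          using gh[of "\<sigma> (\<rho> 0)"] unfolding splits_def by simp
        then have "of_nat C * f 0 \<le> of_nat C * (3 * g (\<sigma> (\<rho> 0)))"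
          by (intro mult_left_mono) auto
        then show "d \<le> of_nat (3 * C) * (g \<circ> \<sigma> \<circ> \<rho>) 0" using d(2) by simp
        show "bounded_at d (g \<circ> \<sigma> \<circ> \<rho>)" using bounded_at_subseq[OF \<sigma>(2) bg] .
      qed (use mono d in auto)
      then show ?thesis using settles_at_subseq[OF \<sigma>(2) \<rho>(1)] by blast
    qed
  qed
  ultimately have "settles_at d (f \<circ> \<sigma>)" unfolding f\<sigma> by (intro settles_at_add)
  then show ?thesis using settles_at_subseq[OF f(1) \<sigma>(1)] by blast
qed

lemma regular_from_bounded:
  assumes f: "mono f" "\<And>n. f n \<in> V0"
    and bnd: "\<And>N (g :: nat \<Rightarrow> 'a). f N \<in> V \<Longrightarrow> mono g \<Longrightarrow> (\<And>n. g n \<in> V0) \<Longrightarrow> (\<And>n. g n < f N) \<Longrightarrow> regular g"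
  shows "regular f"
  unfolding regular_def
proof (intro allI impI, rule ccontr)
  fix d :: 'a assume d: "0 < d" "bounded_at d f" and un: "\<not> settles_at d f"
  obtain N C where N: "\<And>n. N \<le> n \<Longrightarrow> 16 * f n \<le> 17 * f N" "d \<le> of_nat C * f N" "0 < f N"
    using unsettled_tail[OF f(1) V0_nonneg[OF f(2)] d un] by blast
  have sm: "strict_mono (\<lambda>n. N + n)" by (simp add: strict_mono_def)
  have pos: "0 < f (N + n)" for n using N(3) monoD[OF f(1), of N "N + n"] by simp
  have V: "f (N + n) \<in> V" for n using f(2)[of "N + n"] pos[of n] by auto
  have "settles_at d (f \<circ> (\<lambda>n. N + n))"
  proof (rule regular_step)
    show "mono (f \<circ> (\<lambda>n. N + n))" using f(1) by (simp add: mono_def)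
    show "regular g" if "mono g" "\<And>n. g n \<in> V0" "\<And>n. g n < (f \<circ> (\<lambda>n. N + n)) 0"
      for g :: "nat \<Rightarrow> 'a"
      using bnd[of N g] V[of 0] that by simp
    show "bounded_at d (f \<circ> (\<lambda>n. N + n))" using bounded_at_subseq[OF f(1) d(2)] .
  qed (use N V d in auto)
  then show False using settles_at_subseq[OF f(1) sm] un by blast
qed

text \<open>
  Well-founded induction on the bound, in the form of a least counterexample: for a sequence below
  \<open>Q\<close>, a sequence bounded by one of its terms has a smaller bound.
\<close>

lemma regular_below:
  assumes "Q \<in> V" "mono f" "\<And>n. f n \<in> V0" "\<And>n. f n < Q"
  shows "regular f"
proof (rule ccontr)
  assume "\<not> regular f"
  define B where "B = {Q \<in> V. \<exists>f. mono f \<and> (\<forall>n. f n \<in> V0 \<and> f n < Q) \<and> \<not> regular f}"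
  have "B \<subseteq> V" "B \<noteq> {}" using assms \<open>\<not> regular f\<close> unfolding B_def by blast+
  then obtain Q' where Q': "Q' \<in> B" "\<And>P. P \<in> B \<Longrightarrow> Q' \<le> P"
    using well_ordered_V unfolding well_ordered_def by meson
  then obtain f' where f': "mono f'" "\<And>n. f' n \<in> V0" "\<And>n. f' n < Q'" "\<not> regular f'"
    unfolding B_def by blast
  have "regular f'"
  proof (rule regular_from_bounded[OF f'(1,2)])
    fix N and g :: "nat \<Rightarrow> 'a" assume g: "f' N \<in> V" "mono g" "\<And>n. g n \<in> V0" "\<And>n. g n < f' N"
    have "f' N \<notin> B" using Q'(2) f'(3)[of N] by (auto simp: not_le[symmetric])
    then show "regular g" using g unfolding B_def by blast
  qed
  then show False using f'(4) by blast
qed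

text \<open>
  The induction step only appeals to sequences below a term of \<open>f\<close>, and such a term is a bound
  in \<open>V\<close>; this covers sequences that are cofinal in \<open>V\<close> as well.
\<close>

theorem regular_V:
  assumes "mono f" "\<And>n. f n \<in> V"
  shows "regular f"
proof (rule regular_from_bounded)
  show "mono f" by fact
  show "f n \<in> V0" for n using assms(2) by blast
  show "regular g" if "f N \<in> V" "mono g" "\<And>n. g n \<in> V0" "\<And>n. g n < f N" for N g
    using that by (rule regular_below)
qed

end

section \<open>Transfer from the real exponential field\<close>

locale Rexp_extension =
  fixes \<iota> :: "real \<Rightarrow> 'a::linordered_field" and E :: "'a \<Rightarrow> 'a"
  assumes el: "elementary_extension_Rexp \<iota> E"
begin

lemma transfer: "sat exp v p \<longleftrightarrow> sat E (\<iota> \<circ> v) p"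
  using el unfolding elementary_extension_Rexp_def by blast

lemma \<iota>_add: "\<iota> (a + b) = \<iota> a + \<iota> b"
  using transfer[of "(\<lambda>_. 0)(0 := a, 1 := b, 2 := a + b)" "FEq (TVar 2) (TAdd (TVar 0) (TVar 1))"]
  by simp

lemma \<iota>_mult: "\<iota> (a * b) = \<iota> a * \<iota> b"
  using transfer[of "(\<lambda>_. 0)(0 := a, 1 := b, 2 := a * b)" "FEq (TVar 2) (TMul (TVar 0) (TVar 1))"]
  by simp

lemma \<iota>_0 [simp]: "\<iota> 0 = 0"
  using transfer[of "\<lambda>_. 0" "FEq (TVar 0) TZero"] by simp

lemma \<iota>_1 [simp]: "\<iota> 1 = 1"
  using transfer[of "\<lambda>_. 1" "FEq (TVar 0) TOne"] by simp

lemma \<iota>_less [simp]: "\<iota> a < \<iota> b \<longleftrightarrow> a < b"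
  using transfer[of "(\<lambda>_. 0)(0 := a, 1 := b)" "FLess (TVar 0) (TVar 1)"] by simp

lemma \<iota>_le [simp]: "\<iota> a \<le> \<iota> b \<longleftrightarrow> a \<le> b"
  by (meson \<iota>_less not_le)

lemma \<iota>_of_nat [simp]: "\<iota> (of_nat n) = of_nat n"
  by (induction n) (simp_all add: \<iota>_add)

lemma \<iota>_diff: "\<iota> (a - b) = \<iota> a - \<iota> b"
  using \<iota>_add[of "a - b" b] by simp

lemma exponential_field: "exponential_field E"
proof
  fix a b u :: 'a
  have "sat (exp :: real \<Rightarrow> real) (\<lambda>_. 0) (FNot (FEx 0 (FEx 1 (FNot
      (FEq (TExp (TAdd (TVar 0) (TVar 1))) (TMul (TExp (TVar 0)) (TExp (TVar 1))))))))"
    by (simp add: exp_add)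
  then show "E (a + b) = E a * E b" unfolding transfer by simp
  have "sat (exp :: real \<Rightarrow> real) (\<lambda>_. 0) (FNot (FEx 0 (FLess (TExp (TVar 0)) (TAdd TOne (TVar 0)))))"
    by (simp add: not_less exp_ge_add_one_self)
  then show "1 + a \<le> E a" unfolding transfer by (simp add: not_less)
  show "\<exists>w. E w = u" if "0 < u"
    using exp_like_E[OF el] that unfolding exp_like_def by blast
qed

end

section \<open>Sets of limits\<close>

lemma Sk_at_image:
  assumes "elementary_extension_Rexp \<iota> E" "\<And>r. \<iota> r < X"
  shows "Sk_at E X ` Sk = range (skterm_at E X)"
  unfolding Sk_eq_range image_image using Sk_at_skterm_germ[OF assms] by simp

context skolem_values
begin

text \<open>
  The scale of the logarithms is \<open>1 / c\<close>, which is finite exactly because of the lower bound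
  on \<open>c\<close>.
\<close>

lemma log_increments_settle:
  fixes u :: "nat \<Rightarrow> 'a"
  assumes u: "mono u" "\<And>n. u n \<in> V" and c: "1 \<le> c"
    and bdd: "\<And>n. c * (Flog E (u n) - Flog E (u 0)) \<le> of_nat k"
  obtains N where "\<And>m n j. N \<le> m \<Longrightarrow> m \<le> n \<Longrightarrow> of_nat j * (c * (Flog E (u n) - Flog E (u m))) \<le> 1"
proof -
  have c0: "0 < c" "1 / c \<le> of_nat 1" using c by auto
  have pos: "0 < u 0" using V_ge_1[OF u(2)[of 0]] by simp
  have "Flog E (u n) - Flog E (u 0) \<le> of_nat k * (1 / c)" for n
    using bdd[of n] c0 by (simp add: field_simps)
  then have "bounded_at (1 / c) (\<lambda>n. Flog E (u n))" unfolding bounded_at_def by blast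
  then have "settles_at (1 / c) (\<lambda>n. Flog E (u n))"
    using regular_log_settles[OF u(1) pos regular_V[OF u] _ c0(2)] c0(1) by simp
  then obtain N where N: "\<And>m n. N \<le> m \<Longrightarrow> m \<le> n \<Longrightarrow>
      negligible_at (1 / c) (Flog E (u n) - Flog E (u m))" unfolding settles_at_def by blast
  show thesis
  proof (rule that)
    fix m n j assume "N \<le> m" "m \<le> n"
    then have "of_nat j * (Flog E (u n) - Flog E (u m)) \<le> 1 / c"
      using N unfolding negligible_at_def by blast
    then show "of_nat j * (c * (Flog E (u n) - Flog E (u m))) \<le> 1"
      using c0(1) by (simp add: field_simps)
  qed
qed

end

text \<open>
  With $z_n = c \log (u_n / q)$ along a nondecreasing subsequence, the values $E(z_n)$ stay between
  two positive reals, so that the $z_n - z_0$ are bounded by a natural number and consecutive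
  increments of $z$ eventually become infinitesimal. Then those of $E(z)$ do too, and two of the
  limits coincide.
\<close>

lemma limits_not_injective:
  fixes \<iota> :: "real \<Rightarrow> 'a::linordered_field"
  assumes el: "elementary_extension_Rexp \<iota> E" and X: "\<And>r. \<iota> r < X"
    and c: "1 \<le> c" and q: "0 < q"
    and u: "\<And>n. u n \<in> range (skterm_at E X)"
    and r: "\<And>n::nat. 0 < r n" "\<And>n. r n \<le> R"
    and lim: "\<And>n. little_o_one \<iota> (Fpow E (u n / q) c - \<iota> (r n))"
  shows "\<not> inj r"
proof
  assume inj: "inj r"
  interpret Rexp_extension \<iota> E by unfold_locales (rule el)
  interpret exponential_field E by (rule exponential_field)
  have "2 \<le> X" using X[of 2] \<iota>_of_nat[of 2] by simp
  then interpret skolem_values E X by unfold_locales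
  have V: "u n \<in> V" for n using u unfolding V_def .
  obtain \<sigma> :: "nat \<Rightarrow> nat" where \<sigma>: "strict_mono \<sigma>" "mono (u \<circ> \<sigma>)"
    using mono_subseq[OF well_ordered_V, of u] V by blast
  define z where "z = (\<lambda>n. c * Flog E (u (\<sigma> n) / q))"
  have pos: "0 < u n" for n using V_ge_1[OF V[of n]] by simp
  have Flog_div: "Flog E (a / b) = Flog E a - Flog E b" if "0 < a" "0 < b" for a b
    using Flog_E[of "Flog E a - Flog E b"] that by (simp add: E_diff)
  have z_diff: "z n - z m = c * (Flog E (u (\<sigma> n)) - Flog E (u (\<sigma> m)))" for m n
    unfolding z_def using pos q by (simp add: Flog_div algebra_simps)
  have close: "\<bar>E (z n) - \<iota> (r (\<sigma> n))\<bar> < \<iota> \<epsilon>" if "0 < \<epsilon>" for n \<epsilon>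
    using lim[of "\<sigma> n"] that unfolding little_o_one_def Fpow_def z_def by simp
  have upper: "E (z n) \<le> \<iota> (R + 1)" for n
  proof -
    have "\<iota> (r (\<sigma> n)) \<le> \<iota> R" using r by simp
    then show ?thesis using close[of 1 n] unfolding \<iota>_add \<iota>_1 abs_less_iff by linarith
  qed
  define \<delta> where "\<delta> = r (\<sigma> 0) / 2"
  have "0 < \<delta>" using r(1) by (simp add: \<delta>_def)
  have lower: "\<iota> \<delta> \<le> E (z 0)"
  proof -
    have "\<iota> (r (\<sigma> 0)) = \<iota> \<delta> + \<iota> \<delta>" unfolding \<iota>_add[symmetric] by (simp add: \<delta>_def)
    then show ?thesis using close[OF \<open>0 < \<delta>\<close>, of 0] by (simp add: abs_less_iff)
  qed
  have "0 \<le> R + 1" using r[of 0] by simp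
  obtain k :: nat where k: "(R + 1) / \<delta> \<le> of_nat k" using real_arch_simple by blast
  have "z n - z 0 \<le> of_nat k" for n
  proof -
    \<comment> \<open>$E(z_n)/E(z_0) = E(z_n - z_0) \ge 1 + (z_n - z_0)$, multiplied by the lower bound of $E(z_0)$\<close>
    have "\<iota> \<delta> * (1 + (z n - z 0)) \<le> \<iota> \<delta> * E (z n - z 0)"
      using \<open>0 < \<delta>\<close> by (intro mult_left_mono E_ge) (metis \<iota>_0 \<iota>_le less_imp_le)
    also have "\<dots> \<le> E (z 0) * E (z n - z 0)"
      using lower by (intro mult_right_mono) (simp_all add: less_imp_le)
    also have "\<dots> = E (z n)" by (simp add: E_add[symmetric])
    also have "\<dots> \<le> \<iota> (R + 1)" by (rule upper)
    also have "\<dots> \<le> \<iota> (\<delta> * of_nat k)" using k \<open>0 < \<delta>\<close> by (simp add: field_simps)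
    also have "\<dots> = \<iota> \<delta> * of_nat k" by (simp add: \<iota>_mult)
    finally have "1 + (z n - z 0) \<le> of_nat k"
      using \<open>0 < \<delta>\<close> mult_le_cancel_left_pos \<iota>_0 \<iota>_less by metis
    then show ?thesis by simp
  qed
  then obtain N where N: "\<And>m n j. N \<le> m \<Longrightarrow> m \<le> n \<Longrightarrow> of_nat j * (z n - z m) \<le> 1"
    using log_increments_settle[OF \<sigma>(2) _ c, of k] V unfolding z_diff by auto
  let ?a = "r (\<sigma> N)" and ?b = "r (\<sigma> (Suc N))"
  have "?a \<noteq> ?b" using inj \<sigma>(1) by (auto simp: inj_eq strict_mono_eq)
  \<comment> \<open>Two approximation errors and one increment, each at most a quarter of the distance, cannot add up to it.\<close>
  define \<epsilon> where "\<epsilon> = \<bar>?a - ?b\<bar> / 4"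
  have "0 < \<epsilon>" using \<open>?a \<noteq> ?b\<close> by (simp add: \<epsilon>_def)
  obtain j :: nat where j: "(R + 1) / \<epsilon> < of_nat j" using reals_Archimedean2 by blast
  have z_mono: "z N \<le> z (Suc N)"
  proof -
    have "Flog E (u (\<sigma> N)) \<le> Flog E (u (\<sigma> (Suc N)))"
      using monoD[OF \<sigma>(2), of N "Suc N"] pos by (intro Flog_le) auto
    then have "0 \<le> z (Suc N) - z N" unfolding z_diff using c by simp
    then show ?thesis by simp
  qed
  have "of_nat j * (E (z (Suc N)) - E (z N)) \<le> of_nat j * (E (z (Suc N)) * (z (Suc N) - z N))"
    by (intro mult_left_mono E_tangent') simp
  also have "\<dots> = E (z (Suc N)) * (of_nat j * (z (Suc N) - z N))" by (simp add: mult_ac)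
  also have "\<dots> \<le> E (z (Suc N)) * 1" by (intro mult_left_mono N) (auto simp: less_imp_le)
  also have "\<dots> \<le> \<iota> (R + 1)" using upper by simp
  also have "\<dots> \<le> \<iota> (of_nat j * \<epsilon>)" using j \<open>0 < \<epsilon>\<close> by (simp add: field_simps)
  also have "\<dots> = of_nat j * \<iota> \<epsilon>" by (simp add: \<iota>_mult)
  finally have jle: "of_nat j * (E (z (Suc N)) - E (z N)) \<le> of_nat j * \<iota> \<epsilon>" .
  have "0 \<le> (R + 1) / \<epsilon>" using \<open>0 \<le> R + 1\<close> \<open>0 < \<epsilon>\<close> by simp
  then have "0 < j" using j by (cases j) auto
  then have "E (z (Suc N)) - E (z N) \<le> \<iota> \<epsilon>"
    using jle mult_le_cancel_left_pos[of "of_nat j :: 'a"] by simp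
  moreover have "E (z N) \<le> E (z (Suc N))" using z_mono by simp
  ultimately have "\<iota> ?a - \<iota> ?b < \<iota> \<epsilon> + \<iota> \<epsilon> + \<iota> \<epsilon>" "\<iota> ?b - \<iota> ?a < \<iota> \<epsilon> + \<iota> \<epsilon> + \<iota> \<epsilon>"
    using close[OF \<open>0 < \<epsilon>\<close>, of N] close[OF \<open>0 < \<epsilon>\<close>, of "Suc N"]
    unfolding abs_less_iff by linarith+
  then have "\<iota> (?a - ?b) < \<iota> (\<epsilon> + \<epsilon> + \<epsilon>)" "\<iota> (?b - ?a) < \<iota> (\<epsilon> + \<epsilon> + \<epsilon>)"
    unfolding \<iota>_add \<iota>_diff by simp_all
  then show False using \<open>0 < \<epsilon>\<close> unfolding \<epsilon>_def by (simp add: abs_if split: if_splits)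
qed

text \<open>
  If $\omega$ were strictly smaller than the order type of \<open>D\<close>, it would be isomorphic to a proper
  initial segment of \<open>D\<close>; but these are finite.
\<close>

lemma finite_initial_segments_order_type:
  fixes D :: "real set"
  assumes fin: "\<And>R. finite (D \<inter> {..R})"
  shows "well_order_on D (le_on D)" and "\<not> x islimpt D" and "(le_on D, natLeq) \<in> ordLeq"
proof -
  have lin: "linear_order_on D (le_on D)"
    unfolding linear_order_on_def partial_order_on_def preorder_on_def refl_on_def trans_def
      antisym_def total_on_def le_on_def by auto
  have wf: "wf (le_on D - Id)"
  proof (rule wfI_min)
    fix x and B :: "real set" assume x: "x \<in> B"
    show "\<exists>z\<in>B. \<forall>y. (y, z) \<in> le_on D - Id \<longrightarrow> y \<notin> B"
    proof (cases "x \<in> D")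
      case True
      let ?S = "B \<inter> (D \<inter> {..x})"
      have S: "finite ?S" "?S \<noteq> {}" using fin[of x] x True by auto
      have "y \<notin> B" if "(y, Min ?S) \<in> le_on D - Id" for y
      proof
        assume "y \<in> B"
        moreover have "y \<in> D" "y < Min ?S" using that unfolding le_on_def by auto
        moreover have "Min ?S \<le> x" using Min_in[OF S] by auto
        ultimately have "y \<in> ?S" by auto
        then show False using Min_le[OF S(1), of y] \<open>y < Min ?S\<close> by simp
      qed
      then show ?thesis using Min_in[OF S] by blast
    next
      case False
      then show ?thesis using x unfolding le_on_def by blast
    qed
  qed
  show wo: "well_order_on D (le_on D)" unfolding well_order_on_def using lin wf by blast
  show "\<not> x islimpt D"
  proof
    assume "x islimpt D"
    then have "infinite (D \<inter> ball x 1)" unfolding islimpt_eq_infinite_ball by auto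
    moreover have "D \<inter> ball x 1 \<subseteq> D \<inter> {..x + 1}" by (auto simp: dist_real_def)
    ultimately show False using fin[of "x + 1"] finite_subset by blast
  qed
  show "(le_on D, natLeq) \<in> ordLeq"
  proof (rule ccontr)
    have field: "Field (le_on D) = D" unfolding Field_def le_on_def by auto
    then have W: "Well_order (le_on D)" using wo by simp
    assume "(le_on D, natLeq) \<notin> ordLeq"
    then have "(natLeq, le_on D) \<in> ordLess"
      using ordLess_or_ordLeq[OF natLeq_Well_order W] by blast
    then obtain a where a: "a \<in> D" "(natLeq, Restr (le_on D) (underS (le_on D) a)) \<in> ordIso"
      using ordLess_iff_ordIso_Restr[OF W natLeq_Well_order] field by blast
    let ?r = "Restr (le_on D) (underS (le_on D) a)"
    obtain f where "iso natLeq ?r f" using a(2) unfolding ordIso_def by blast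
    then have "bij_betw f (Field natLeq) (Field ?r)" unfolding iso_def by blast
    moreover have "Field ?r \<subseteq> D \<inter> {..a}" unfolding Field_def underS_def le_on_def by auto
    then have "finite (Field ?r)" using fin finite_subset by blast
    ultimately show False using bij_betw_finite[of f "Field natLeq" "Field ?r"] Field_natLeq by auto
  qed
qed

theorem theorem4p5:
  fixes \<iota> :: "real \<Rightarrow> 'a::linordered_field" and E :: "'a \<Rightarrow> 'a"
    and X c :: 'a and Q :: germ
  assumes "elementary_extension_Rexp \<iota> E"
    and "\<And>r::real. \<iota> r < X"
    and "Q \<in> Sk"
    and "c \<ge> 1"
  shows "well_order_on (D_set \<iota> E X c Q) (le_on (D_set \<iota> E X c Q))
    \<and> (\<forall>x::real. \<not> x islimpt D_set \<iota> E X c Q)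
    \<and> (\<forall>R::real. R > 0 \<longrightarrow> finite (D_set \<iota> E X c Q \<inter> {0<..R}))
    \<and> (le_on (D_set \<iota> E X c Q), natLeq) \<in> ordLeq"
proof -
  let ?D = "D_set \<iota> E X c Q"
  have fin: "finite (?D \<inter> {..R})" for R
  proof (rule ccontr)
    assume "infinite (?D \<inter> {..R})"
    then obtain r :: "nat \<Rightarrow> real" where r: "inj r" "range r \<subseteq> ?D \<inter> {..R}"
      using infinite_countable_subset by blast
    then have rD: "r n \<in> ?D" "r n \<le> R" for n by auto
    have "\<exists>f\<in>Sk. little_o_one \<iota> (Fpow E (Sk_at E X f / Sk_at E X Q) c - \<iota> (r n))" for n
      using rD(1)[of n] unfolding D_set_def by blast
    then obtain f where f: "\<And>n. f n \<in> Sk"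
      "\<And>n. little_o_one \<iota> (Fpow E (Sk_at E X (f n) / Sk_at E X Q) c - \<iota> (r n))" by metis
    have range: "Sk_at E X g \<in> range (skterm_at E X)" if "g \<in> Sk" for g
      using Sk_at_image[OF assms(1,2)] that by blast
    obtain t where "Sk_at E X Q = skterm_at E X t" using range[OF assms(3)] by blast
    moreover have "0 < X"
    proof -
      interpret Rexp_extension \<iota> E by unfold_locales (rule assms(1))
      show ?thesis using assms(2)[of 0] by simp
    qed
    ultimately have "0 < Sk_at E X Q" using skterm_at_pos[OF exp_like_E[OF assms(1)]] by simp
    then have "\<not> inj r"
      using f range rD unfolding D_set_def
      by (intro limits_not_injective[OF assms(1,2,4), where u = "\<lambda>n. Sk_at E X (f n)" and R = R]) auto
    then show False using r(1) by blast
  qed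
  have "finite (?D \<inter> {0<..R})" for R
    using fin[of R] by (rule finite_subset[rotated]) auto
  then show ?thesis using finite_initial_segments_order_type[OF fin] by blast
qed

end
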